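(* Let $T$ be a $J$-self-adjoint operator. Assume that $T_{\min}$ is densely defined in $H$ and $n_+ (T_{\min}) = n_- (T_{\min}) =: m < \infty$. Then: (i) $m$ is even and $n_+ (T_{\min}^+) = n_- (T_{\min}^+) = n_+ (T_{\min}^-) = n_- (T_{\min}^-) = m/2$. (ii) Let $\{ \mathbb C^{m/2}, \Gamma_0^+ , \Gamma_1^+\}$ be a boundary triple for $T_{\max}^+ $. Then there exists a boundary triple $\{ \mathbb C^{m/2}, \Gamma_0^- , \Gamma_1^- \}$ for $T_{\max}^- $ such that \[ \operatorname{dom}(T) = \{h \in \mathcal{D}_{\max}: \ \Gamma_0^+ P_+ h =\Gamma_0^- P_- h, \ \Gamma_1^+ P_+ h =\Gamma_1^- P_- h \}. \]
   Context: $J=J^*=J^{-1}$ is a signature operator in a Hilbert space $H$, $H_\pm=\ker(J\mp I)$, $P_\pm$ the orthogonal projections onto $H_\pm$. $T$ is $J$-self-adjoint ($JT$ self-adjoint), $T_{\min}:=T\cap T^*$, $\mathcal D_{\min}=\operatorname{dom}(T_{\min})$, $T_{\min}^\pm:=T\upharpoonright(\mathcal D_{\min}\cap H_\pm)$ (symmetric operators in $H_\pm$ with $T_{\min}=T_{\min}^+\oplus T_{\min}^-$), $T_{\max}^\pm:=(T_{\min}^\pm)^*$, $\mathcal D_{\max}^\pm:=\operatorname{dom}(T_{\max}^\pm)$, $\mathcal D_{\max}:=\mathcal D_{\max}^+\oplus\mathcal D_{\max}^-$. $n_\pm$ denote deficiency indices. A boundary triple $\{\mathcal H,\Gamma_0,\Gamma_1\}$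 for $S^*$ ($S$ closed densely defined symmetric) consists of a Hilbert space $\mathcal H$ and linear maps $\Gamma_j:\operatorname{dom}(S^* )\to\mathcal H$ with $(S^*f,g)-(f,S^*g)=(\Gamma_1f,\Gamma_0g)_{\mathcal H}-(\Gamma_0f,\Gamma_1g)_{\mathcal H}$ for all $f,g\in\operatorname{dom}(S^* )$ and $f\mapsto\{\Gamma_0f,\Gamma_1f\}$ surjective onto $\mathcal H\oplus\mathcal H$. *)

theory Defs
  imports Main "HOL-Analysis.Analysis"
begin

text \<open>Setting: a complex Hilbert space is modelled on a type 'a with addition,
  a complex scalar multiplication sc and an inner product ip, linear in the
  first argument and conjugate linear in the second.
  Unbounded (possibly multivalued) operators are modelled by their graphs,
  i.e. sets of pairs, so that intersection T \<inter> T* and adjoints are literal.\<close>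

definition hnorm :: "('a \<Rightarrow> 'a \<Rightarrow> complex) \<Rightarrow> 'a \<Rightarrow> real" where
  "hnorm ip x = sqrt (Re (ip x x))"

definition hilbert_space ::
  "(complex \<Rightarrow> 'a::ab_group_add \<Rightarrow> 'a) \<Rightarrow> ('a \<Rightarrow> 'a \<Rightarrow> complex) \<Rightarrow> bool" where
  "hilbert_space sc ip \<longleftrightarrow>
     vector_space sc \<and>
     (\<forall>x y z. ip (x + y) z = ip x z + ip y z) \<and>
     (\<forall>c x y. ip (sc c x) y = c * ip x y) \<and>
     (\<forall>x y. ip y x = cnj (ip x y)) \<and>
     (\<forall>x. x \<noteq> 0 \<longrightarrow> Re (ip x x) > 0) \<and>
     (\<forall>X :: nat \<Rightarrow> 'a. (\<forall>e>0. \<exists>N. \<forall>m\<ge>N. \<forall>n\<ge>N. hnorm ip (X m - X n) < e)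
         \<longrightarrow> (\<exists>L. \<forall>e>0. \<exists>N. \<forall>n\<ge>N. hnorm ip (X n - L) < e))"

definition hdense :: "('a::ab_group_add \<Rightarrow> 'a \<Rightarrow> complex) \<Rightarrow> 'a set \<Rightarrow> bool" where
  "hdense ip D \<longleftrightarrow> (\<forall>x. \<forall>e>0. \<exists>d\<in>D. hnorm ip (x - d) < e)"

definition signature_op ::
  "(complex \<Rightarrow> 'a::ab_group_add \<Rightarrow> 'a) \<Rightarrow> ('a \<Rightarrow> 'a \<Rightarrow> complex) \<Rightarrow> ('a \<Rightarrow> 'a) \<Rightarrow> bool" where
  "signature_op sc ip J \<longleftrightarrow>
     (\<forall>x y. J (x + y) = J x + J y) \<and> (\<forall>c x. J (sc c x) = sc c (J x)) \<and>
     (\<forall>x. J (J x) = x) \<and> (\<forall>x y. ip (J x) y = ip x (J y))"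

definition is_operator :: "(complex \<Rightarrow> 'a::ab_group_add \<Rightarrow> 'a) \<Rightarrow> ('a \<times> 'a) set \<Rightarrow> bool" where
  "is_operator sc T \<longleftrightarrow>
     (0, 0) \<in> T \<and>
     (\<forall>x y x' y'. (x, y) \<in> T \<longrightarrow> (x', y') \<in> T \<longrightarrow> (x + x', y + y') \<in> T) \<and>
     (\<forall>c x y. (x, y) \<in> T \<longrightarrow> (sc c x, sc c y) \<in> T) \<and>
     (\<forall>y. (0, y) \<in> T \<longrightarrow> y = 0)"

definition adj_in :: "('a \<Rightarrow> 'a \<Rightarrow> complex) \<Rightarrow> 'a set \<Rightarrow> ('a \<times> 'a) set \<Rightarrow> ('a \<times> 'a) set" where
  "adj_in ip V T = {(y, z). y \<in> V \<and> z \<in> V \<and> (\<forall>(x, w) \<in> T. ip w y = ip x z)}"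

abbreviation adj :: "('a \<Rightarrow> 'a \<Rightarrow> complex) \<Rightarrow> ('a \<times> 'a) set \<Rightarrow> ('a \<times> 'a) set" where
  "adj ip T \<equiv> adj_in ip UNIV T"

definition op_comp_left :: "('a \<Rightarrow> 'a) \<Rightarrow> ('a \<times> 'a) set \<Rightarrow> ('a \<times> 'a) set" where
  "op_comp_left J T = {(x, J y) | x y. (x, y) \<in> T}"

definition J_self_adjoint ::
  "(complex \<Rightarrow> 'a::ab_group_add \<Rightarrow> 'a) \<Rightarrow> ('a \<Rightarrow> 'a \<Rightarrow> complex) \<Rightarrow> ('a \<Rightarrow> 'a) \<Rightarrow> ('a \<times> 'a) set \<Rightarrow> bool" where
  "J_self_adjoint sc ip J T \<longleftrightarrow> is_operator sc T \<and> op_comp_left J T = adj ip (op_comp_left J T)"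

definition Tmin :: "('a \<Rightarrow> 'a \<Rightarrow> complex) \<Rightarrow> ('a \<times> 'a) set \<Rightarrow> ('a \<times> 'a) set" where
  "Tmin ip T = T \<inter> adj ip T"

definition Hplus :: "('a \<Rightarrow> 'a) \<Rightarrow> 'a set" where "Hplus J = {x. J x = x}"
definition Hminus :: "('a::ab_group_add \<Rightarrow> 'a) \<Rightarrow> 'a set" where "Hminus J = {x. J x = - x}"

definition orth_proj :: "('a::ab_group_add \<Rightarrow> 'a \<Rightarrow> complex) \<Rightarrow> 'a set \<Rightarrow> 'a \<Rightarrow> 'a" where
  "orth_proj ip V x = (THE p. p \<in> V \<and> (\<forall>v\<in>V. ip (x - p) v = 0))"

definition Tmin_plus :: "('a \<Rightarrow> 'a \<Rightarrow> complex) \<Rightarrow> ('a \<Rightarrow> 'a) \<Rightarrow> ('a \<times> 'a) set \<Rightarrow> ('a \<times> 'a) set" where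
  "Tmin_plus ip J T = {(x, y) \<in> T. x \<in> Domain (Tmin ip T) \<and> x \<in> Hplus J}"
definition Tmin_minus :: "('a::ab_group_add \<Rightarrow> 'a \<Rightarrow> complex) \<Rightarrow> ('a \<Rightarrow> 'a) \<Rightarrow> ('a \<times> 'a) set \<Rightarrow> ('a \<times> 'a) set" where
  "Tmin_minus ip J T = {(x, y) \<in> T. x \<in> Domain (Tmin ip T) \<and> x \<in> Hminus J}"

definition Tmax_plus where "Tmax_plus ip J T = adj_in ip (Hplus J) (Tmin_plus ip J T)"
definition Tmax_minus where "Tmax_minus ip J T = adj_in ip (Hminus J) (Tmin_minus ip J T)"

definition has_dim :: "(complex \<Rightarrow> 'a::ab_group_add \<Rightarrow> 'a) \<Rightarrow> 'a set \<Rightarrow> nat \<Rightarrow> bool" where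
  "has_dim sc V k \<longleftrightarrow>
     (\<exists>B. finite B \<and> card B = k \<and> B \<subseteq> V \<and> \<not> module.dependent sc B \<and> module.span sc B = V)"

definition defect_space ::
  "(complex \<Rightarrow> 'a \<Rightarrow> 'a) \<Rightarrow> ('a \<Rightarrow> 'a \<Rightarrow> complex) \<Rightarrow> 'a set \<Rightarrow> ('a \<times> 'a) set \<Rightarrow> complex \<Rightarrow> 'a set" where
  "defect_space sc ip V S lam = {y. (y, sc lam y) \<in> adj_in ip V S}"

definition def_index_plus_is where
  "def_index_plus_is sc ip V S k \<longleftrightarrow> has_dim sc (defect_space sc ip V S \<i>) k"
definition def_index_minus_is where
  "def_index_minus_is sc ip V S k \<longleftrightarrow> has_dim sc (defect_space sc ip V S (- \<i>)) k"

definition Cvec :: "nat \<Rightarrow> (nat \<Rightarrow> complex) set" where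
  "Cvec k = {v. \<forall>j\<ge>k. v j = 0}"

definition cip :: "nat \<Rightarrow> (nat \<Rightarrow> complex) \<Rightarrow> (nat \<Rightarrow> complex) \<Rightarrow> complex" where
  "cip k v w = (\<Sum>j<k. v j * cnj (w j))"

text \<open>{C^k, \<Gamma>0, \<Gamma>1} is a boundary triple for A = S* (A given as a graph).\<close>
definition boundary_triple ::
  "(complex \<Rightarrow> 'a::ab_group_add \<Rightarrow> 'a) \<Rightarrow> ('a \<Rightarrow> 'a \<Rightarrow> complex) \<Rightarrow> ('a \<times> 'a) set \<Rightarrow> nat
   \<Rightarrow> ('a \<Rightarrow> nat \<Rightarrow> complex) \<Rightarrow> ('a \<Rightarrow> nat \<Rightarrow> complex) \<Rightarrow> bool" where
  "boundary_triple sc ip A k \<Gamma>0 \<Gamma>1 \<longleftrightarrow>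
     (\<forall>f\<in>Domain A. \<Gamma>0 f \<in> Cvec k \<and> \<Gamma>1 f \<in> Cvec k) \<and>
     (\<forall>f\<in>Domain A. \<forall>g\<in>Domain A. \<Gamma>0 (f + g) = (\<lambda>j. \<Gamma>0 f j + \<Gamma>0 g j) \<and> \<Gamma>1 (f + g) = (\<lambda>j. \<Gamma>1 f j + \<Gamma>1 g j)) \<and>
     (\<forall>f\<in>Domain A. \<forall>c. \<Gamma>0 (sc c f) = (\<lambda>j. c * \<Gamma>0 f j) \<and> \<Gamma>1 (sc c f) = (\<lambda>j. c * \<Gamma>1 f j)) \<and>
     (\<forall>f f' g g'. (f, f') \<in> A \<longrightarrow> (g, g') \<in> A \<longrightarrow>
        ip f' g - ip f g' = cip k (\<Gamma>1 f) (\<Gamma>0 g) - cip k (\<Gamma>0 f) (\<Gamma>1 g)) \<and>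
     (\<forall>a\<in>Cvec k. \<forall>b\<in>Cvec k. \<exists>f\<in>Domain A. \<Gamma>0 f = a \<and> \<Gamma>1 f = b)"

end

theory Submission
  imports Defs
begin

text \<open>
  Let \<open>S = T \<inter> T*\<close> and \<open>A = S*\<close>. Since \<open>T* = J T J\<close>, both commute with \<open>J\<close>, so \<open>A\<close> splits into
  \<open>A\<^sub>+ \<oplus> A\<^sub>-\<close>. Write \<open>\<omega>\<^sub>\<plusminus>\<close> for the boundary forms \<open>(A f, g) - (f, A g)\<close> on \<open>A\<^sub>\<plusminus>\<close>.
  Self-adjointness of \<open>J T\<close> says that \<open>T\<close> is its own annihilator for \<open>\<omega>\<^sub>+ - \<omega>\<^sub>-\<close>, and
  \<open>T \<inter> A\<^sub>\<plusminus> \<subseteq> S\<close>. The annihilator of \<open>P\<^sub>+ T\<close> in \<open>A\<^sub>+\<close> is therefore contained in \<open>S\<close>, and because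
  \<open>A\<^sub>+\<close> is finite-dimensional modulo \<open>S\<close> this forces \<open>P\<^sub>+ T = A\<^sub>+\<close>; likewise \<open>P\<^sub>- T = A\<^sub>-\<close>. So
  \<open>T\<close> is, modulo \<open>S\<close>, the graph of a bijection from \<open>A\<^sub>+\<close> to \<open>A\<^sub>-\<close> that carries \<open>\<omega>\<^sub>+\<close> to \<open>\<omega>\<^sub>-\<close>.
  By von Neumann's decomposition the deficiency indices are the signature of the form
  \<open>\<omega>\<^sub>\<plusminus> / 2i\<close>, hence agree on both sides, and a boundary triple is transported along the bijection.
\<close>

section \<open>Hilbert spaces\<close>

locale hilbert =
  fixes sc :: "complex \<Rightarrow> 'a::ab_group_add \<Rightarrow> 'a" and ip :: "'a \<Rightarrow> 'a \<Rightarrow> complex"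
  assumes hilbert_space: "hilbert_space sc ip"
begin

sublocale vector_space sc
  using hilbert_space by (simp add: hilbert_space_def)

lemma half_double: "sc (1/2) (x + x) = x"
proof -
  have "sc (1/2) (x + x) = sc (1/2 + 1/2) x"
    by (simp only: scale_right_distrib scale_left_distrib)
  then show ?thesis by simp
qed

lemma ip_add_left: "ip (x + y) z = ip x z + ip y z"
  and ip_scale_left: "ip (sc c x) z = c * ip x z"
  and ip_pos: "x \<noteq> 0 \<Longrightarrow> Re (ip x x) > 0"
  and ip_cnj: "cnj (ip x y) = ip y x"
  using hilbert_space unfolding hilbert_space_def by metis+

lemma hilbert_complete:
  fixes X :: "nat \<Rightarrow> 'a"
  assumes "\<forall>e>0. \<exists>N. \<forall>m\<ge>N. \<forall>n\<ge>N. hnorm ip (X m - X n) < e"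
  shows "\<exists>L. \<forall>e>0. \<exists>N. \<forall>n\<ge>N. hnorm ip (X n - L) < e"
proof -
  have "\<forall>X :: nat \<Rightarrow> 'a. (\<forall>e>0. \<exists>N. \<forall>m\<ge>N. \<forall>n\<ge>N. hnorm ip (X m - X n) < e)
    \<longrightarrow> (\<exists>L. \<forall>e>0. \<exists>N. \<forall>n\<ge>N. hnorm ip (X n - L) < e)"
    using hilbert_space unfolding hilbert_space_def by (elim conjE) assumption
  then show ?thesis using assms by (rule spec[where x = X, THEN mp])
qed

lemma ip_add_right: "ip z (x + y) = ip z x + ip z y"
  using ip_add_left[of x y z] ip_cnj by (metis complex_cnj_add)

lemma ip_scale_right: "ip z (sc c x) = cnj c * ip z x"
  using ip_scale_left[of c x z] ip_cnj by (metis complex_cnj_mult)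

lemma ip_zero_left [simp]: "ip 0 z = 0"
  using ip_scale_left[of 0 0 z] by simp

lemma ip_zero_right [simp]: "ip z 0 = 0"
  using ip_scale_right[of z 0 0] by simp

lemma ip_minus_left: "ip (- x) z = - ip x z"
  using ip_add_left[of x "- x" z] by (simp add: eq_neg_iff_add_eq_0 add.commute)

lemma ip_minus_right: "ip z (- x) = - ip z x"
  using ip_add_right[of z x "- x"] by (simp add: eq_neg_iff_add_eq_0 add.commute)

lemma ip_diff_left: "ip (x - y) z = ip x z - ip y z"
  using ip_add_left[of x "- y" z] by (simp add: ip_minus_left)

lemma ip_diff_right: "ip z (x - y) = ip z x - ip z y"
  using ip_add_right[of z x "- y"] by (simp add: ip_minus_right)

lemmas ip_simps = ip_add_left ip_add_right ip_scale_left ip_scale_right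
  ip_minus_left ip_minus_right ip_diff_left ip_diff_right

lemma ip_self: "ip x x = of_real (Re (ip x x))"
  using ip_cnj[of x x] by (metis complex_cnj_cancel_iff Reals_cnj_iff of_real_Re)

lemma ip_ge_0: "Re (ip x x) \<ge> 0"
  using ip_pos[of x] by (cases "x = 0") auto

lemma ip_eq_0_iff: "ip x x = 0 \<longleftrightarrow> x = 0"
  using ip_pos[of x] by (cases "x = 0") auto

lemma ip_sum_eq_0_iff: "ip x x + ip y y = 0 \<longleftrightarrow> x = 0 \<and> y = 0"
proof
  assume "ip x x + ip y y = 0"
  then have "Re (ip x x) + Re (ip y y) = 0"
    by (metis plus_complex.simps(1) zero_complex.simps(1))
  then show "x = 0 \<and> y = 0"
    using ip_ge_0[of x] ip_ge_0[of y] ip_pos[of x] ip_pos[of y] by fastforce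
qed auto

text \<open>Pythagoras for removing the component along \<open>v\<close>. Nonnegativity of the left
  side yields Cauchy-Schwarz, and the exact gain later bounds \<open>ip (x - Y n) v\<close> along a
  minimising sequence.\<close>

lemma residual_norm:
  assumes "v \<noteq> 0"
  shows "Re (ip (r - sc (ip r v / ip v v) v) (r - sc (ip r v / ip v v) v))
    = Re (ip r r) - (cmod (ip r v))\<^sup>2 / Re (ip v v)"
proof -
  have nz: "ip v v \<noteq> 0" using assms ip_eq_0_iff by blast
  have "ip (r - sc (ip r v / ip v v) v) (r - sc (ip r v / ip v v) v)
    = ip r r - ip r v * ip v r / ip v v"
    using nz by (simp add: ip_simps ip_cnj)
  also have "ip r v * ip v r = of_real ((cmod (ip r v))\<^sup>2)"
    by (metis complex_norm_square ip_cnj)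
  also have "of_real ((cmod (ip r v))\<^sup>2) / ip v v = of_real ((cmod (ip r v))\<^sup>2 / Re (ip v v))"
    by (subst ip_self[of v]) simp
  finally show ?thesis by (metis Re_complex_of_real minus_complex.simps(1))
qed

lemma Cauchy_Schwarz_sq: "(cmod (ip r v))\<^sup>2 \<le> Re (ip r r) * Re (ip v v)"
proof (cases "v = 0")
  case False
  then show ?thesis
    using residual_norm[OF False, of r] ip_ge_0[of "r - sc (ip r v / ip v v) v"] ip_pos[of v]
    by (simp add: divide_le_eq)
qed simp

lemma Cauchy_Schwarz: "cmod (ip r v) \<le> hnorm ip r * hnorm ip v"
proof -
  have "cmod (ip r v) = sqrt ((cmod (ip r v))\<^sup>2)" by simp
  also have "\<dots> \<le> sqrt (Re (ip r r) * Re (ip v v))"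
    using Cauchy_Schwarz_sq real_sqrt_le_iff by blast
  finally show ?thesis by (simp add: hnorm_def real_sqrt_mult)
qed

lemma hnorm_ge_0: "hnorm ip x \<ge> 0"
  by (simp add: hnorm_def ip_ge_0)

lemma hnorm_power2: "(hnorm ip x)\<^sup>2 = Re (ip x x)"
  by (simp add: hnorm_def ip_ge_0)

lemma limit_ip:
  assumes "\<forall>e>0. \<exists>N. \<forall>n\<ge>N. hnorm ip (X n - L) < e"
  shows "(\<lambda>n. ip (X n) v) \<longlonglongrightarrow> ip L v"
proof -
  have X: "(\<lambda>n. hnorm ip (X n - L)) \<longlonglongrightarrow> 0"
    using assms by (simp add: LIMSEQ_iff hnorm_ge_0)
  have "(\<lambda>n. hnorm ip (X n - L) * hnorm ip v) \<longlonglongrightarrow> 0"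
    using tendsto_mult_right[OF X, of "hnorm ip v"] by simp
  then have "(\<lambda>n. ip (X n - L) v) \<longlonglongrightarrow> 0"
    by (rule Lim_null_comparison[rotated]) (simp add: Cauchy_Schwarz)
  then show ?thesis
    by (simp add: ip_diff_left LIM_zero_iff)
qed

lemma eq_0_if_orth_hdense:
  assumes D: "hdense ip D" and y: "\<And>d. d \<in> D \<Longrightarrow> ip d y = 0"
  shows "y = 0"
proof (rule ccontr)
  assume "y \<noteq> 0"
  then have pos: "hnorm ip y > 0" using ip_pos by (simp add: hnorm_def)
  then obtain d where d: "d \<in> D" "hnorm ip (y - d) < hnorm ip y"
    using D unfolding hdense_def by blast
  have "ip y y = ip (y - d) y" using y[OF d(1)] by (simp add: ip_diff_left)
  then have "(hnorm ip y)\<^sup>2 \<le> hnorm ip (y - d) * hnorm ip y"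
    using Cauchy_Schwarz[of "y - d" y] ip_self[of y] hnorm_power2[of y]
    by (metis norm_of_real abs_of_nonneg ip_ge_0)
  with d(2) pos show False
    by (simp add: power2_eq_square)
qed

section \<open>Orthogonal projections\<close>

lemma parallelogram:
  "Re (ip (x - y) (x - y)) = 2 * Re (ip x x) + 2 * Re (ip y y)
     - 4 * Re (ip (sc (1/2) (x + y)) (sc (1/2) (x + y)))"
  by (simp add: ip_simps field_simps)

text \<open>An annihilator is automatically closed, because \<open>ip\<close> is continuous in its
  first argument. The minimising-sequence argument therefore applies without a separate notion of
  closed subspace.\<close>

lemma projection_orthocomplement:
  fixes X :: "'a set"
  defines "W \<equiv> {w. \<forall>z\<in>X. ip w z = 0}"
  shows "\<exists>p\<in>W. \<forall>w\<in>W. ip (x - p) w = 0"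
proof -
  have W: "0 \<in> W" "\<And>u v. u \<in> W \<Longrightarrow> v \<in> W \<Longrightarrow> u + v \<in> W" "\<And>c u. u \<in> W \<Longrightarrow> sc c u \<in> W"
    by (auto simp: W_def ip_simps)
  define f where "f w = Re (ip (x - w) (x - w))" for w
  define d where "d = Inf (f ` W)"
  have bdd: "bdd_below (f ` W)"
    by (rule bdd_belowI[of _ 0]) (auto simp: f_def ip_ge_0)
  have d_le: "d \<le> f w" if "w \<in> W" for w
    unfolding d_def by (rule cInf_lower) (use that bdd in auto)
  have "\<exists>w\<in>W. f w < d + inverse (real (Suc n))" for n
  proof -
    have "d < d + inverse (real (Suc n))" by simp
    then have "\<exists>t\<in>f ` W. t < d + inverse (real (Suc n))"
      unfolding d_def using bdd W(1) by (subst (asm) cInf_less_iff) auto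
    then show ?thesis by blast
  qed
  then obtain Y where Y: "\<And>n. Y n \<in> W" "\<And>n. f (Y n) < d + inverse (real (Suc n))"
    by metis
  \<comment> \<open>The midpoint of \<open>Y m\<close> and \<open>Y n\<close> stays in
    \<open>W\<close>, so its \<open>f\<close>-value is at least \<open>d\<close>; the parallelogram
    law then bounds the squared distance of the two points.\<close>
  have dist: "Re (ip (Y m - Y n) (Y m - Y n)) \<le> 2 * inverse (real (Suc m)) + 2 * inverse (real (Suc n))"
    for m n
  proof -
    have mid: "sc (1/2) ((x - Y n) + (x - Y m)) = x - sc (1/2) (Y n + Y m)"
    proof -
      have "(x - Y n) + (x - Y m) = (x + x) - (Y n + Y m)" by simp
      then show ?thesis by (simp only: scale_right_diff_distrib half_double)
    qed
    have "Y m - Y n = (x - Y n) - (x - Y m)" by simp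
    then have "Re (ip (Y m - Y n) (Y m - Y n)) = 2 * f (Y n) + 2 * f (Y m) - 4 * f (sc (1/2) (Y n + Y m))"
      unfolding f_def using parallelogram[of "x - Y n" "x - Y m"] mid by metis
    then show ?thesis
      using d_le[of "sc (1/2) (Y n + Y m)"] W(2,3) Y(1) Y(2)[of n] Y(2)[of m] by fastforce
  qed
  have "\<exists>L. \<forall>e>0. \<exists>N. \<forall>n\<ge>N. hnorm ip (Y n - L) < e"
  proof (rule hilbert_complete, intro allI impI)
    fix e :: real assume e: "e > 0"
    then obtain N where N: "inverse (real (Suc N)) < e\<^sup>2 / 4"
      using reals_Archimedean[of "e\<^sup>2 / 4"] by auto
    have "hnorm ip (Y m - Y n) < e" if "m \<ge> N" "n \<ge> N" for m n
    proof -
      have "inverse (real (Suc m)) \<le> inverse (real (Suc N))"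
        "inverse (real (Suc n)) \<le> inverse (real (Suc N))" using that by (auto simp: field_simps)
      then have "(hnorm ip (Y m - Y n))\<^sup>2 < e\<^sup>2" using dist[of m n] N
        unfolding hnorm_power2 by linarith
      then show ?thesis using e by (simp add: power2_less_imp_less)
    qed
    then show "\<exists>N. \<forall>m\<ge>N. \<forall>n\<ge>N. hnorm ip (Y m - Y n) < e" by blast
  qed
  then obtain L where L: "\<forall>e>0. \<exists>N. \<forall>n\<ge>N. hnorm ip (Y n - L) < e" by blast
  have lim: "(\<lambda>n. ip (Y n) v) \<longlonglongrightarrow> ip L v" for v by (rule limit_ip[OF L])
  have "ip L z = 0" if "z \<in> X" for z
  proof -
    have "(\<lambda>n. ip (Y n) z) = (\<lambda>n. 0)" using Y(1) that by (auto simp: W_def)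
    then show ?thesis using lim[of z] LIMSEQ_unique tendsto_const by metis
  qed
  then have "L \<in> W" by (simp add: W_def)
  moreover have "ip (x - L) v = 0" if v: "v \<in> W" for v
  proof (cases "v = 0")
    case False
    \<comment> \<open>\<open>c\<close> is the optimal coefficient along \<open>v\<close>: passing
      from \<open>Y n\<close> to \<open>Y n + sc c v\<close> lowers \<open>f\<close> by the quotient
      in \<open>residual_norm\<close>, yet \<open>f\<close> cannot fall below
      \<open>d\<close>.\<close>
    have bound: "norm (ip (x - Y n) v) \<le> sqrt (inverse (real (Suc n)) * Re (ip v v))" for n
    proof -
      define c where "c = ip (x - Y n) v / ip v v"
      have "d \<le> f (Y n + sc c v)" using W v Y(1) d_le by blast
      also have "f (Y n + sc c v) = f (Y n) - (cmod (ip (x - Y n) v))\<^sup>2 / Re (ip v v)"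
        using residual_norm[OF False, of "x - Y n"]
        by (simp add: f_def c_def diff_diff_add)
      finally have "(cmod (ip (x - Y n) v))\<^sup>2 / Re (ip v v) \<le> inverse (real (Suc n))"
        using Y(2)[of n] by linarith
      then have "(cmod (ip (x - Y n) v))\<^sup>2 \<le> inverse (real (Suc n)) * Re (ip v v)"
        using ip_pos[OF False] by (simp add: pos_divide_le_eq)
      then show ?thesis by (simp add: real_le_rsqrt)
    qed
    have "(\<lambda>n. sqrt (inverse (real (Suc n)) * Re (ip v v))) \<longlonglongrightarrow> sqrt (0 * Re (ip v v))"
      by (intro tendsto_intros LIMSEQ_inverse_real_of_nat)
    then have "(\<lambda>n. sqrt (inverse (real (Suc n)) * Re (ip v v))) \<longlonglongrightarrow> 0" by simp
    then have "(\<lambda>n. ip (x - Y n) v) \<longlonglongrightarrow> 0"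
      by (rule Lim_null_comparison[OF always_eventually, rotated]) (rule allI bound)+
    moreover have "(\<lambda>n. ip (x - Y n) v) \<longlonglongrightarrow> ip (x - L) v"
      unfolding ip_diff_left by (intro tendsto_intros lim)
    ultimately show ?thesis using LIMSEQ_unique by blast
  qed simp
  ultimately show ?thesis by blast
qed

text \<open>Gram-Schmidt: \<open>r\<close> is the part of the new generator \<open>b\<close>
  orthogonal to \<open>span B\<close>. If \<open>r = 0\<close>, division by zero gives
  \<open>c = 0\<close>, so a dependent generator leaves \<open>p\<close> unchanged.\<close>

lemma projection_span:
  assumes "finite B"
  shows "\<exists>p\<in>span B. \<forall>w\<in>span B. ip (x - p) w = 0"
  using assms
proof (induction B arbitrary: x)
  case (insert b B)
  obtain q where q: "q \<in> span B" "\<And>w. w \<in> span B \<Longrightarrow> ip (b - q) w = 0"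
    using insert.IH by metis
  obtain p where p: "p \<in> span B" "\<And>w. w \<in> span B \<Longrightarrow> ip (x - p) w = 0"
    using insert.IH by metis
  define r where "r = b - q"
  define c where "c = ip (x - p) r / ip r r"
  have sub: "span B \<subseteq> span (insert b B)" by (rule span_mono) auto
  have r: "r \<in> span (insert b B)"
    unfolding r_def using q(1) sub by (meson insertI1 span_base span_diff subsetD)
  have orth: "ip r w = 0" "ip w r = 0" if "w \<in> span B" for w
    using q(2)[OF that] ip_cnj[of r w] unfolding r_def by auto
  have "ip (x - (p + sc c r)) w = 0" if "w \<in> span (insert b B)" for w
  proof -
    obtain k where k: "w - sc k b \<in> span B" using \<open>w \<in> span (insert b B)\<close> by (auto simp: span_breakdown_eq)
    have "w - sc k r = (w - sc k b) + sc k q"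
      by (simp add: r_def scale_right_diff_distrib)
    then have u: "w - sc k r \<in> span B" using k span_scale[OF q(1)] span_add by metis
    have rr: "ip (x - (p + sc c r)) r = 0"
      by (cases "r = 0") (simp_all add: ip_simps c_def ip_eq_0_iff)
    have "w = (w - sc k r) + sc k r" by simp
    then have "ip (x - (p + sc c r)) w = ip (x - (p + sc c r)) (w - sc k r) + cnj k * ip (x - (p + sc c r)) r"
      by (metis ip_add_right ip_scale_right)
    then show ?thesis
      using rr p(2)[OF u] orth(1)[OF u]
      by (simp add: ip_add_left ip_diff_left ip_scale_left algebra_simps)
  qed
  moreover have "p + sc c r \<in> span (insert b B)"
    using p(1) r sub by (auto intro: span_add span_scale)
  ultimately show ?case by blast
qed auto

lemma projection_finite_dim_subspace:
  assumes "finite C" "W \<subseteq> span C" "subspace W"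
  shows "\<exists>p\<in>W. \<forall>w\<in>W. ip (x - p) w = 0"
proof -
  obtain B where B: "B \<subseteq> W" "independent B" "W \<subseteq> span B"
    using maximal_independent_subset by blast
  then have "finite B" using independent_span_bound[of C B] assms by blast
  moreover have "span B = W" using B assms(3) by (simp add: span_subspace)
  ultimately show ?thesis using projection_span by metis
qed

text \<open>Graphs are subspaces of the sum of two copies of the space. The von Neumann
  decomposition and the surjectivity argument for \<open>T\<close> both project there.\<close>

lemma hilbert_space_prod:
  "hilbert_space (\<lambda>c v. (sc c (fst v), sc c (snd v))) (\<lambda>u v. ip (fst u) (fst v) + ip (snd u) (snd v))"
  (is "hilbert_space ?sc ?ip")
proof -
  have "vector_space ?sc"
    by unfold_locales (auto simp: scale_left_distrib scale_right_distrib)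
  moreover have "Re (?ip x x) > 0" if "x \<noteq> 0" for x
  proof -
    have "fst x \<noteq> 0 \<or> snd x \<noteq> 0" using that by (metis prod.collapse zero_prod_def)
    then show ?thesis
      using ip_pos[of "fst x"] ip_pos[of "snd x"] ip_ge_0[of "fst x"] ip_ge_0[of "snd x"]
      by auto
  qed
  moreover have "\<exists>L. \<forall>e>0. \<exists>N. \<forall>n\<ge>N. hnorm ?ip (X n - L) < e"
    if X: "\<forall>e>0. \<exists>N. \<forall>m\<ge>N. \<forall>n\<ge>N. hnorm ?ip (X m - X n) < e" for X :: "nat \<Rightarrow> 'a \<times> 'a"
  proof -
    have le: "hnorm ip (fst u) \<le> hnorm ?ip u" "hnorm ip (snd u) \<le> hnorm ?ip u"
      "hnorm ?ip u \<le> hnorm ip (fst u) + hnorm ip (snd u)" for u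
      using sqrt_add_le_add_sqrt[of "Re (ip (fst u) (fst u))" "Re (ip (snd u) (snd u))"]
      by (auto simp: hnorm_def ip_ge_0)
    have "\<exists>L. \<forall>e>0. \<exists>N. \<forall>n\<ge>N. hnorm ip (fst (X n) - L) < e"
    proof (rule hilbert_complete, intro allI impI)
      fix e :: real assume "e > 0"
      then obtain N where "\<And>m n. m \<ge> N \<Longrightarrow> n \<ge> N \<Longrightarrow> hnorm ?ip (X m - X n) < e"
        using X by blast
      then have "hnorm ip (fst (X m) - fst (X n)) < e" if "m \<ge> N" "n \<ge> N" for m n
        using le(1)[of "X m - X n"] that by (auto intro: le_less_trans)
      then show "\<exists>N. \<forall>m\<ge>N. \<forall>n\<ge>N. hnorm ip (fst (X m) - fst (X n)) < e" by blast
    qed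
    moreover have "\<exists>L. \<forall>e>0. \<exists>N. \<forall>n\<ge>N. hnorm ip (snd (X n) - L) < e"
    proof (rule hilbert_complete, intro allI impI)
      fix e :: real assume "e > 0"
      then obtain N where "\<And>m n. m \<ge> N \<Longrightarrow> n \<ge> N \<Longrightarrow> hnorm ?ip (X m - X n) < e"
        using X by blast
      then have "hnorm ip (snd (X m) - snd (X n)) < e" if "m \<ge> N" "n \<ge> N" for m n
        using le(2)[of "X m - X n"] that by (auto intro: le_less_trans)
      then show "\<exists>N. \<forall>m\<ge>N. \<forall>n\<ge>N. hnorm ip (snd (X m) - snd (X n)) < e" by blast
    qed
    ultimately obtain L1 L2 where L: "\<forall>e>0. \<exists>N. \<forall>n\<ge>N. hnorm ip (fst (X n) - L1) < e"
      "\<forall>e>0. \<exists>N. \<forall>n\<ge>N. hnorm ip (snd (X n) - L2) < e" by blast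
    have "\<exists>N. \<forall>n\<ge>N. hnorm ?ip (X n - (L1, L2)) < e" if "e > 0" for e
    proof -
      obtain N1 N2 where N: "\<And>n. n \<ge> N1 \<Longrightarrow> hnorm ip (fst (X n) - L1) < e / 2"
        "\<And>n. n \<ge> N2 \<Longrightarrow> hnorm ip (snd (X n) - L2) < e / 2"
        using L[THEN spec, of "e / 2"] \<open>e > 0\<close> by auto
      have "hnorm ?ip (X n - (L1, L2)) < e" if "n \<ge> max N1 N2" for n
        using N[of n] le(3)[of "X n - (L1, L2)"] that by simp
      then show ?thesis by blast
    qed
    then show ?thesis by blast
  qed
  ultimately show ?thesis
    unfolding hilbert_space_def by (auto simp: ip_simps ip_cnj algebra_simps)
qed

end

section \<open>Dimension\<close>

context vector_space
begin

lemma independent_Un_if_direct: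
  assumes "finite C" "independent B" "independent C" "span B \<inter> span C \<subseteq> {0}"
  shows "independent (B \<union> C) \<and> B \<inter> C = {}"
  using assms
proof (induction C)
  case (insert c C)
  have ind: "independent C" "c \<notin> span C"
    using insert.prems(2) insert.hyps(2) by (auto simp: independent_insert)
  have sub: "span C \<subseteq> span (insert c C)" by (rule span_mono) auto
  then have IH: "independent (B \<union> C)" "B \<inter> C = {}"
    using insert.IH insert.prems ind by blast+
  have c: "c \<notin> span (B \<union> C)"
  proof
    assume "c \<in> span (B \<union> C)"
    then obtain x y where xy: "x \<in> span B" "y \<in> span C" "c = x + y"
      by (auto simp: span_Un)
    then have "x = c - y" by simp
    then have "x \<in> span (insert c C)" using xy(2) sub
      by (metis insertI1 span_base span_diff subsetD)
    then have "x = 0" using xy(1) insert.prems(3) by blast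
    then show False using xy ind(2) by simp
  qed
  then have "c \<notin> B \<union> C" using span_base by blast
  with c IH show ?case by (simp add: independent_insertI)
qed auto

end

context
  fixes sc :: "complex \<Rightarrow> 'a::ab_group_add \<Rightarrow> 'a"
  assumes vector_space: "vector_space sc"
begin

interpretation vector_space sc by (rule vector_space)

text \<open>Choosing a related vector for each basis element and extending linearly gives a map
  whose graph over \<open>V\<close> lies in \<open>R\<close>; the last hypothesis makes it
  injective. A relation is convenient because the later correspondence of defect spaces is given
  only by the existence of representatives.\<close>

lemma has_dim_le_if_linear_relation:
  assumes V: "has_dim sc V k" and W: "has_dim sc W l"
    and add: "\<And>x y x' y'. R x y \<Longrightarrow> R x' y' \<Longrightarrow> R (x + x') (y + y')"
    and scale: "\<And>c x y. R x y \<Longrightarrow> R (sc c x) (sc c y)"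
    and total: "\<And>x. x \<in> V \<Longrightarrow> \<exists>y\<in>W. R x y"
    and inj: "\<And>x. x \<in> V \<Longrightarrow> R x 0 \<Longrightarrow> x = 0"
  shows "k \<le> l"
proof -
  interpret vp: vector_space_pair sc sc by unfold_locales
  obtain B where B: "finite B" "card B = k" "B \<subseteq> V" "independent B" "span B = V"
    using V by (auto simp: has_dim_def)
  obtain C where C: "finite C" "card C = l" "span C = W"
    using W by (auto simp: has_dim_def)
  obtain g where g: "\<And>b. b \<in> B \<Longrightarrow> g b \<in> W \<and> R b (g b)"
    using total B(3) by (metis subsetD)
  obtain h where h: "Vector_Spaces.linear sc sc h" "\<And>b. b \<in> B \<Longrightarrow> h b = g b"
    using vp.linear_independent_extend[OF B(4), of g] by auto
  interpret h: Vector_Spaces.linear sc sc h by fact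
  have R: "R x (h x)" if x: "x \<in> span B" for x
    using x
  proof (induction rule: span_induct_alt)
    case base
    show ?case
    proof -
      obtain y where "R 0 y" using total[of 0] B(5) span_zero by blast
      from scale[OF this, of 0] show ?thesis by (simp add: h.zero)
    qed
  next
    case (step c x y)
    then show ?case using g h(2) add scale by (simp add: h.add h.scale)
  qed
  have inj_h: "inj_on h (span B)"
  proof (rule inj_onI)
    fix x y assume xy: "x \<in> span B" "y \<in> span B" "h x = h y"
    then have "R (x - y) 0" using R[of "x - y"] by (simp add: h.diff span_diff)
    then show "x = y" using inj[of "x - y"] xy B(5) span_diff by fastforce
  qed
  have "independent (h ` B)"
    using vp.linear_independent_injective_image[OF h(1) B(4) inj_h] .
  moreover have "h ` B \<subseteq> span C" using g h(2) C(3) by auto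
  ultimately have "card (h ` B) \<le> card C"
    using independent_span_bound[OF C(1)] by blast
  moreover have "card (h ` B) = card B"
    by (rule card_image) (meson inj_h inj_on_subset span_superset)
  ultimately show ?thesis using B C by simp
qed

lemma has_dim_subspace_exists:
  assumes "has_dim sc V k" "W \<subseteq> V" "subspace W"
  shows "\<exists>l. has_dim sc W l"
proof -
  obtain C where C: "finite C" "span C = V" using assms(1) by (auto simp: has_dim_def)
  obtain B where B: "B \<subseteq> W" "independent B" "W \<subseteq> span B"
    using maximal_independent_subset by blast
  then have "finite B" using independent_span_bound[of C B] assms C by blast
  moreover have "span B = W" using B assms(3) by (simp add: span_subspace)
  ultimately show ?thesis using B unfolding has_dim_def by blast
qed

lemma has_dim_direct_sum:
  assumes V: "has_dim sc V k" and W: "has_dim sc W l" and "V \<inter> W \<subseteq> {0}"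
    and U: "has_dim sc {x + y | x y. x \<in> V \<and> y \<in> W} n"
  shows "n = k + l"
proof -
  obtain B where B: "finite B" "card B = k" "independent B" "span B = V"
    using V by (auto simp: has_dim_def)
  obtain C where C: "finite C" "card C = l" "independent C" "span C = W"
    using W by (auto simp: has_dim_def)
  obtain D where D: "card D = n" "independent D" "span D = {x + y | x y. x \<in> V \<and> y \<in> W}"
    using U by (auto simp: has_dim_def)
  have "independent (B \<union> C)" "B \<inter> C = {}"
    using independent_Un_if_direct[of C B] B C assms(3) by auto
  moreover have "span (B \<union> C) = span D" using B C D by (auto simp: span_Un)
  ultimately show ?thesis
    using B C D by (metis card_Un_disjoint dim_span_eq_card_independent)
qed

end

section \<open>Adjoints and von Neumann's decomposition\<close>

text \<open>Lets \<open>l\<close> stand for either \<i> or its negative, so that both deficiency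
  indices are handled by one argument.\<close>

lemma cnj_square_minus_one:
  assumes "l * l = (- 1 :: complex)"
  shows "cnj l = - l"
proof -
  have "(l - \<i>) * (l + \<i>) = 0" using assms by (simp add: algebra_simps)
  then have "l = \<i> \<or> l = - \<i>" by (auto simp: eq_neg_iff_add_eq_0)
  then show ?thesis by auto
qed

context hilbert
begin

lemma adj_iff: "(y, z) \<in> adj ip X \<longleftrightarrow> (\<forall>x w. (x, w) \<in> X \<longrightarrow> ip w y = ip x z)"
  by (auto simp: adj_in_def)

lemma adj_add: "(x, w) \<in> adj ip X \<Longrightarrow> (y, z) \<in> adj ip X \<Longrightarrow> (x + y, w + z) \<in> adj ip X"
  by (auto simp: adj_iff ip_add_right)

lemma adj_scale: "(x, w) \<in> adj ip X \<Longrightarrow> (sc c x, sc c w) \<in> adj ip X"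
  by (auto simp: adj_iff ip_scale_right)

lemma adj_diff: "(x, w) \<in> adj ip X \<Longrightarrow> (y, z) \<in> adj ip X \<Longrightarrow> (x - y, w - z) \<in> adj ip X"
  by (auto simp: adj_iff ip_diff_right)

lemma adj_zero: "(0, 0) \<in> adj ip X"
  by (auto simp: adj_iff)

text \<open>Once each pair \<open>(x, w)\<close> of \<open>X\<close> is rotated to
  \<open>(w, - x)\<close>, the adjoint is an orthogonal complement in the sum of two copies of the
  space, and \<open>projection_orthocomplement\<close> applies.\<close>

lemma projection_adj:
  "\<exists>s s'. (s, s') \<in> adj ip X \<and> (\<forall>u u'. (u, u') \<in> adj ip X \<longrightarrow> ip (f - s) u + ip (f' - s') u' = 0)"
proof -
  interpret prod: hilbert "\<lambda>c v. (sc c (fst v), sc c (snd v))"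
    "\<lambda>u v. ip (fst u) (fst v) + ip (snd u) (snd v)"
    by (rule hilbert.intro) (rule hilbert_space_prod)
  have eq: "{v. \<forall>z\<in>{(w, - x) | x w. (x, w) \<in> X}. ip (fst v) (fst z) + ip (snd v) (snd z) = 0} = adj ip X"
  proof (intro set_eqI)
    fix v
    have "ip w y = ip x z \<longleftrightarrow> ip y w + ip z (- x) = 0" for x w y z
      by (metis ip_cnj ip_minus_right add.right_inverse eq_neg_iff_add_eq_0 minus_minus)
    then show "v \<in> {v. \<forall>z\<in>{(w, - x) | x w. (x, w) \<in> X}. ip (fst v) (fst z) + ip (snd v) (snd z) = 0}
      \<longleftrightarrow> v \<in> adj ip X"
      by (cases v) (auto simp: adj_iff)
  qed
  show ?thesis
    using prod.projection_orthocomplement[of "{(w, - x) | x w. (x, w) \<in> X}" "(f, f')"]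
    unfolding eq by fastforce
qed

text \<open>In the graph inner product \<open>S\<close> is orthogonal to the defect pairs, since
  moving \<open>l\<close> out of the second slot produces the conjugate of
  \<open>l * l\<close>.\<close>

lemma defect_orthogonal:
  assumes l: "l * l = - 1" and "(x, w) \<in> S" "(a, sc l a) \<in> adj ip S"
  shows "ip x a + ip w (sc l a) = 0"
proof -
  have "ip w a = ip x (sc l a)" using assms by (auto simp: adj_iff)
  then have "ip w (sc l a) = cnj (l * l) * ip x a" by (simp add: ip_scale_right)
  then show ?thesis using l by simp
qed

text \<open>Being an adjoint, \<open>S\<close> admits a projection of \<open>(f, f')\<close>. The
  residual \<open>(g, g')\<close> lies in \<open>adj ip S\<close>, and its orthogonality to
  \<open>S\<close> says that \<open>(g', - g)\<close> lies there too.\<close>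

lemma von_Neumann_decomposition:
  assumes l: "l * l = - 1" and S: "S = adj ip X" "S \<subseteq> adj ip S" and f: "(f, f') \<in> adj ip S"
  shows "\<exists>s s' a b. (s, s') \<in> S \<and> (a, sc l a) \<in> adj ip S \<and> (b, sc (- l) b) \<in> adj ip S
    \<and> f = s + a + b \<and> f' = s' + sc l a + sc (- l) b"
proof -
  obtain s s' where s: "(s, s') \<in> S" "\<And>u u'. (u, u') \<in> S \<Longrightarrow> ip (f - s) u + ip (f' - s') u' = 0"
    using projection_adj[of X f f'] S(1) by auto
  define g g' where "g = f - s" and "g' = f' - s'"
  have g: "(g, g') \<in> adj ip S"
    using adj_diff f s(1) S(2) unfolding g_def g'_def by blast
  have g2: "(g', - g) \<in> adj ip S"
  proof -
    have "ip w g' = ip x (- g)" if "(x, w) \<in> S" for x w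
      using s(2)[OF that] ip_cnj unfolding g_def[symmetric] g'_def[symmetric]
      by (metis add_eq_0_iff complex_cnj_minus ip_minus_right)
    then show ?thesis by (auto simp: adj_iff)
  qed
  \<comment> \<open>The adjoint sends \<open>g\<close> to \<open>g'\<close> and \<open>g'\<close> to
    \<open>- g\<close>. As \<open>l * l = - 1\<close>, these are the components of \<open>g\<close>
    for the eigenvalues \<open>l\<close> and \<open>- l\<close> of that rotation.\<close>
  define a b where "a = sc (1/2) (g - sc l g')" and "b = sc (1/2) (g + sc l g')"
  have ll: "sc l (sc l x) = - x" for x using l scale_minus_left[of 1 x] by simp
  have a': "sc l a = sc (1/2) (g' + sc l g)"
  proof -
    have "sc l a = sc (1/2) (sc l (g - sc l g'))" by (simp add: a_def mult.commute)
    also have "sc l (g - sc l g') = g' + sc l g"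
      by (simp only: scale_right_diff_distrib ll) simp
    finally show ?thesis .
  qed
  have b': "sc (- l) b = sc (1/2) (g' - sc l g)"
  proof -
    have "sc (- l) b = sc (1/2) (sc (- l) (g + sc l g'))" by (simp add: b_def mult.commute)
    also have "sc (- l) (g + sc l g') = g' - sc l g"
      by (simp only: scale_right_distrib scale_minus_left ll) simp
    finally show ?thesis .
  qed
  have "(a, sc l a) \<in> adj ip S"
    using adj_scale[OF adj_diff[OF g adj_scale[OF g2, of l]], of "1/2"] by (simp add: a' flip: a_def)
  moreover have "(b, sc (- l) b) \<in> adj ip S"
    using adj_scale[OF adj_add[OF g adj_scale[OF g2, of l]], of "1/2"]
    by (simp add: b' del: scale_minus_left flip: b_def)
  moreover have ab: "a + b = g"
    unfolding a_def b_def scale_right_distrib[symmetric] by (simp add: half_double)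
  moreover have ab': "sc l a + sc (- l) b = g'"
    unfolding a' b' scale_right_distrib[symmetric] by (simp add: half_double)
  moreover have "f = s + a + b" "f' = s' + sc l a + sc (- l) b"
    using ab ab' by (simp_all add: g_def g'_def add.assoc del: scale_minus_left)
  ultimately show ?thesis using s(1) by blast
qed

end

lemma cip_zero_left [simp]: "cip k (\<lambda>j. 0) w = 0"
  by (simp add: cip_def)

lemma cip_zero_right [simp]: "cip k w (\<lambda>j. 0) = 0"
  by (simp add: cip_def)

lemma cip_self_eq_0:
  assumes "v \<in> Cvec k" "cip k v v = 0"
  shows "v = (\<lambda>j. 0)"
proof
  fix j
  have "cip k v v = of_real (\<Sum>j<k. (cmod (v j))\<^sup>2)"
    unfolding cip_def of_real_sum by (intro sum.cong refl) (rule complex_norm_square[symmetric])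
  then have "(\<Sum>j<k. (cmod (v j))\<^sup>2) = 0" using assms(2) by (metis of_real_eq_0_iff)
  then have "\<forall>j<k. v j = 0" by (simp add: sum_nonneg_eq_0_iff)
  then show "v j = 0" using assms(1) by (cases "j < k") (auto simp: Cvec_def)
qed

section \<open>J-self-adjoint operators\<close>

text \<open>For a signature operator this is the orthogonal projection onto the eigenspace of 1.
  \<open>J\<close> is an argument so that \<open>- J\<close> yields the other projection and every
  plus-side fact has a minus-side instance.\<close>

definition sym_part :: "(complex \<Rightarrow> 'a::ab_group_add \<Rightarrow> 'a) \<Rightarrow> ('a \<Rightarrow> 'a) \<Rightarrow> 'a \<Rightarrow> 'a" where
  "sym_part sc J x = sc (1/2) (x + J x)"

locale J_self_adjoint_operator = hilbert sc ip
  for sc :: "complex \<Rightarrow> 'a::ab_group_add \<Rightarrow> 'a" and ip +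
  fixes J :: "'a \<Rightarrow> 'a" and T :: "('a \<times> 'a) set"
  assumes signature: "signature_op sc ip J"
    and J_self_adjoint: "J_self_adjoint sc ip J T"
    and hdense: "hdense ip (Domain (Tmin ip T))"
begin

abbreviation "S \<equiv> Tmin ip T"
abbreviation "A \<equiv> adj ip S"
abbreviation "P \<equiv> sym_part sc J"
abbreviation "Q \<equiv> sym_part sc (\<lambda>x. - J x)"

lemma J_add: "J (x + y) = J x + J y"
  and J_scale: "J (sc c x) = sc c (J x)"
  and J_J [simp]: "J (J x) = x"
  and J_ip: "ip (J x) y = ip x (J y)"
  using signature by (auto simp: signature_op_def)

lemma J_minus: "J (- x) = - J x"
  using J_scale[of "-1" x] by simp

lemma J_diff: "J (x - y) = J x - J y"
  using J_add[of x "- y"] by (simp add: J_minus)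

lemma J_zero [simp]: "J 0 = 0"
  using J_scale[of 0 0] by simp

lemma J_eq_minus_iff: "- J x = x \<longleftrightarrow> J x = - x"
  by (metis minus_minus)

text \<open>Replacing \<open>J\<close> by \<open>- J\<close> exchanges the plus and the minus side.\<close>

lemma neg: "J_self_adjoint_operator sc ip (\<lambda>x. - J x) T"
proof
  show "signature_op sc ip (\<lambda>x. - J x)"
    by (auto simp: signature_op_def J_add J_scale J_minus ip_minus_left ip_minus_right J_ip)
  have op: "op_comp_left (\<lambda>x. - J x) T = {(x, - y) | x y. (x, y) \<in> op_comp_left J T}"
    by (auto simp: op_comp_left_def)
  have adj: "adj ip {(x, - y) | x y. (x, y) \<in> X} = {(x, - y) | x y. (x, y) \<in> adj ip X}" for X
  proof (intro set_eqI)
    fix v :: "'a \<times> 'a"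
    obtain y z where v: "v = (y, z)" by (cases v)
    have "v \<in> adj ip {(x, - y) | x y. (x, y) \<in> X} \<longleftrightarrow> (y, - z) \<in> adj ip X"
    proof -
      have "v \<in> adj ip {(x, - y) | x y. (x, y) \<in> X} \<longleftrightarrow> (\<forall>x w. (x, w) \<in> X \<longrightarrow> ip (- w) y = ip x z)"
        unfolding v adj_iff by blast
      moreover have "- c = d \<longleftrightarrow> c = - d" for c d :: complex by auto
      ultimately show ?thesis by (simp only: adj_iff ip_minus_left ip_minus_right)
    qed
    also have "\<dots> \<longleftrightarrow> v \<in> {(x, - y) | x y. (x, y) \<in> adj ip X}"
      unfolding v by (auto intro: exI[of _ "- z"])
    finally show "v \<in> adj ip {(x, - y) | x y. (x, y) \<in> X}
      \<longleftrightarrow> v \<in> {(x, - y) | x y. (x, y) \<in> adj ip X}" .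
  qed
  have "is_operator sc T" "adj ip (op_comp_left J T) = op_comp_left J T"
    using J_self_adjoint by (simp_all add: J_self_adjoint_def)
  then show "J_self_adjoint sc ip (\<lambda>x. - J x) T"
    by (simp only: J_self_adjoint_def op adj)
qed (rule hdense)

lemma T_zero: "(0, 0) \<in> T"
  and T_add: "(x, w) \<in> T \<Longrightarrow> (y, z) \<in> T \<Longrightarrow> (x + y, w + z) \<in> T"
  and T_scale: "(x, w) \<in> T \<Longrightarrow> (sc c x, sc c w) \<in> T"
  using J_self_adjoint by (auto simp: J_self_adjoint_def is_operator_def)

lemma T_diff: "(x, w) \<in> T \<Longrightarrow> (y, z) \<in> T \<Longrightarrow> (x - y, w - z) \<in> T"
  using T_add[OF _ T_scale[of y z "-1"]] by fastforce

text \<open>The working form of self-adjointness of \<open>J T\<close>. From left to right,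
  \<open>T\<close> is isotropic for \<open>ip (J w) y - ip x (J z)\<close>; from right to left,
  \<open>T\<close> contains everything that this form annihilates.\<close>

lemma T_iff: "(y, z) \<in> T \<longleftrightarrow> (\<forall>x w. (x, w) \<in> T \<longrightarrow> ip (J w) y = ip x (J z))"
proof -
  have "(y, z) \<in> T \<longleftrightarrow> (y, J z) \<in> op_comp_left J T"
    by (auto simp: op_comp_left_def) (metis J_J)
  also have "\<dots> \<longleftrightarrow> (y, J z) \<in> adj ip (op_comp_left J T)"
    using J_self_adjoint by (simp add: J_self_adjoint_def)
  finally show ?thesis by (auto simp: adj_iff op_comp_left_def)
qed

lemma adj_T_iff: "(y, z) \<in> adj ip T \<longleftrightarrow> (J y, J z) \<in> T"
  unfolding adj_iff T_iff[of "J y"] by (simp add: J_ip)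

lemma S_iff: "(y, z) \<in> S \<longleftrightarrow> (y, z) \<in> T \<and> (J y, J z) \<in> T"
  by (simp add: Tmin_def adj_T_iff)

text \<open>\<open>T\<close> is the adjoint of its conjugate by \<open>J\<close>, so
  \<open>S\<close> is an intersection of two adjoints, hence the adjoint of a union. This is the
  shape that \<open>von_Neumann_decomposition\<close> requires.\<close>

lemma S_eq_adj: "S = adj ip (T \<union> {(J x, J w) | x w. (x, w) \<in> T})"
proof -
  have "(y, z) \<in> S \<longleftrightarrow> (y, z) \<in> adj ip (T \<union> {(J x, J w) | x w. (x, w) \<in> T})" for y z
  proof -
    have "(y, z) \<in> S \<longleftrightarrow> (J y, J z) \<in> adj ip T \<and> (y, z) \<in> adj ip T"
      by (simp add: S_iff adj_T_iff)
    also have "(J y, J z) \<in> adj ip T \<longleftrightarrow> (y, z) \<in> adj ip {(J x, J w) | x w. (x, w) \<in> T}"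
      unfolding adj_iff J_ip[symmetric] by blast
    finally show ?thesis unfolding adj_iff by blast
  qed
  then show ?thesis by auto
qed

lemma S_subset_T: "S \<subseteq> T"
  by (auto simp: S_iff)

lemma T_subset_A: "T \<subseteq> A"
proof (clarify, unfold adj_iff, intro allI impI)
  fix y z x w assume "(y, z) \<in> T" "(x, w) \<in> S"
  then have "ip z x = ip y w" by (auto simp: Tmin_def adj_iff)
  then show "ip w y = ip x z" by (metis ip_cnj)
qed

lemma S_subset_A: "S \<subseteq> A"
  using S_subset_T T_subset_A by blast

lemma S_J: "(x, w) \<in> S \<Longrightarrow> (J x, J w) \<in> S"
  by (simp add: S_iff)

lemma A_J: "(x, w) \<in> A \<Longrightarrow> (J x, J w) \<in> A"
  using S_J by (auto simp: adj_iff J_ip[symmetric])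

text \<open>Two images of \<open>x\<close> have the same inner products with the dense set
  \<open>Domain S\<close>.\<close>

lemma A_functional:
  assumes "(x, w) \<in> A" "(x, w') \<in> A"
  shows "w = w'"
proof -
  have "w - w' = 0"
    by (rule eq_0_if_orth_hdense[OF hdense])
      (use assms in \<open>auto simp: adj_iff ip_diff_right\<close>)
  then show ?thesis by simp
qed

text \<open>\<open>A\<close> commutes with \<open>J\<close> and is single-valued, so
  \<open>J x = x\<close> forces \<open>J w = w\<close>. The pair is then its own conjugate, and
  \<open>S_iff\<close> applies.\<close>

lemma T_plus:
  assumes "(x, w) \<in> T" "J x = x"
  shows "J w = w" "(x, w) \<in> S"
proof -
  have "(x, w) \<in> A" using assms T_subset_A by auto
  with A_J[OF this] assms(2) show "J w = w" using A_functional by metis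
  with assms show "(x, w) \<in> S" by (simp add: S_iff)
qed

section \<open>Projections onto the eigenspaces of \<open>J\<close>\<close>

lemma J_P: "J (P x) = P x"
  by (simp add: sym_part_def J_scale J_add add.commute)

lemma P_eq: "J x = x \<Longrightarrow> P x = x"
  by (simp add: sym_part_def half_double)

lemma P_add: "P (x + y) = P x + P y"
  by (simp add: sym_part_def J_add scale_right_distrib algebra_simps)

lemma P_scale: "P (sc c x) = sc c (P x)"
  by (simp add: sym_part_def J_scale scale_right_distrib mult.commute)

lemma P_zero [simp]: "P 0 = 0"
  by (simp add: P_eq)

lemma P_ip: "ip (P x) y = ip x (P y)"
  by (simp add: sym_part_def ip_simps J_ip)

lemma P_Q: "P x + Q x = x"
proof -
  have "P x + Q x = sc (1/2) (x + x)"
    by (simp add: sym_part_def scale_right_distrib[symmetric] del: scale_minus_right)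
  then show ?thesis by (simp add: half_double)
qed

lemma P_diff_Q: "P x - Q x = J x"
proof -
  have "P x - Q x = sc (1/2) (J x + J x)"
    unfolding sym_part_def scale_right_diff_distrib[symmetric] by simp
  then show ?thesis by (simp add: half_double)
qed

lemma orth_proj_Hplus: "orth_proj ip (Hplus J) x = P x"
  unfolding orth_proj_def
proof (rule the_equality)
  have P: "P x \<in> Hplus J \<and> (\<forall>v\<in>Hplus J. ip (x - P x) v = 0)"
    by (auto simp: Hplus_def J_P ip_diff_left P_ip P_eq)
  then show "P x \<in> Hplus J \<and> (\<forall>v\<in>Hplus J. ip (x - P x) v = 0)" .
  fix p assume p: "p \<in> Hplus J \<and> (\<forall>v\<in>Hplus J. ip (x - p) v = 0)"
  then have "p - P x \<in> Hplus J" using P by (auto simp: Hplus_def J_diff)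
  then have "ip (x - p) (p - P x) = 0" "ip (x - P x) (p - P x) = 0" using p P by auto
  then have "ip (p - P x) (p - P x) = 0" by (simp add: ip_diff_left)
  then show "p = P x" by (simp add: ip_eq_0_iff)
qed

section \<open>Plus parts of \<open>S\<close> and \<open>A\<close>\<close>

lemma Tmin_plus_iff: "(x, w) \<in> Tmin_plus ip J T \<longleftrightarrow> (x, w) \<in> S \<and> J x = x"
  using T_plus S_subset_T by (auto simp: Tmin_plus_def Hplus_def)

lemma S_P:
  assumes "(x, w) \<in> S"
  shows "(P x, P w) \<in> S"
  using assms by (auto simp: sym_part_def S_iff J_scale J_add intro!: T_scale T_add)

lemma A_P:
  assumes "(x, w) \<in> A"
  shows "(P x, P w) \<in> A"
  using A_J[OF assms] assms unfolding sym_part_def by (intro adj_scale adj_add)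

text \<open>Testing against the plus part of \<open>S\<close> suffices, because \<open>P\<close>
  maps \<open>S\<close> into itself, is symmetric, and fixes \<open>y\<close> and
  \<open>z\<close>.\<close>

lemma Tmax_plus_iff: "(y, z) \<in> Tmax_plus ip J T \<longleftrightarrow> (y, z) \<in> A \<and> J y = y \<and> J z = z"
proof
  assume "(y, z) \<in> A \<and> J y = y \<and> J z = z"
  then show "(y, z) \<in> Tmax_plus ip J T"
    by (auto simp: Tmax_plus_def adj_in_def Tmin_plus_iff Hplus_def)
next
  assume yz: "(y, z) \<in> Tmax_plus ip J T"
  then have J: "J y = y" "J z = z" by (auto simp: Tmax_plus_def adj_in_def Hplus_def)
  have "ip w y = ip x z" if "(x, w) \<in> S" for x w
  proof -
    have "(P x, P w) \<in> Tmin_plus ip J T" using S_P[OF that] by (simp add: Tmin_plus_iff J_P)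
    then have "ip (P w) y = ip (P x) z" using yz by (auto simp: Tmax_plus_def adj_in_def)
    then show ?thesis by (simp add: P_ip P_eq J)
  qed
  then show "(y, z) \<in> A \<and> J y = y \<and> J z = z" using J by (auto simp: adj_iff)
qed

lemma defect_space_plus:
  "defect_space sc ip (Hplus J) (Tmin_plus ip J T) l = {a. (a, sc l a) \<in> A \<and> J a = a}"
proof -
  have "(a, sc l a) \<in> adj_in ip (Hplus J) (Tmin_plus ip J T) \<longleftrightarrow> (a, sc l a) \<in> A \<and> J a = a" for a
    using Tmax_plus_iff[of a "sc l a"] by (auto simp: Tmax_plus_def J_scale)
  then show ?thesis by (simp add: defect_space_def)
qed

text \<open>For \<open>g\<close> and \<open>g'\<close> fixed by \<open>J\<close>, the form in
  \<open>T_iff\<close> sees only the \<open>P\<close>-components of \<open>T\<close>.\<close>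

lemma T_plusI:
  assumes "J g = g" "J g' = g'" "\<And>x w. (x, w) \<in> T \<Longrightarrow> ip (P w) g = ip (P x) g'"
  shows "(g, g') \<in> T"
  unfolding T_iff[of g] using assms by (simp add: J_ip P_ip P_eq)

text \<open>Since \<open>J = P - Q\<close> and the ranges of \<open>P\<close> and \<open>Q\<close>
  are orthogonal, isotropy of \<open>T\<close> becomes equality of the boundary forms of its two
  components.\<close>

lemma T_form:
  assumes "(x, w) \<in> T" "(y, z) \<in> T"
  shows "ip (P w) (P y) - ip (P x) (P z) = ip (Q w) (Q y) - ip (Q x) (Q z)"
proof -
  have ip_J: "ip (J u) v = ip (P u) (P v) - ip (Q u) (Q v)" for u v
  proof -
    have "ip (J u) v = ip (P u - Q u) (P v + Q v)" by (simp only: P_Q P_diff_Q)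
    moreover have "ip (P u) (Q v) = 0"
    proof -
      have "P (Q v) = 0" using P_add[of "P v" "Q v"] by (simp add: P_Q P_eq J_P)
      then show ?thesis by (simp add: P_ip)
    qed
    moreover have "ip (Q u) (P v) = 0"
    proof -
      have "P (Q u) = 0" using P_add[of "P u" "Q u"] by (simp add: P_Q P_eq J_P)
      then show ?thesis by (simp add: P_ip[symmetric])
    qed
    ultimately show ?thesis by (simp add: ip_simps)
  qed
  have "ip (J w) y = ip x (J z)" using assms T_iff by blast
  then have "ip (J w) y = ip (J x) z" by (simp add: J_ip)
  then show ?thesis unfolding ip_J by (simp add: algebra_simps)
qed

lemma von_Neumann_plus:
  assumes l: "l * l = - 1" and f: "(f, f') \<in> A" "J f = f" "J f' = f'"
  shows "\<exists>s s' a b. (s, s') \<in> S \<and> J s = s \<and> (a, sc l a) \<in> A \<and> J a = a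
    \<and> (b, sc (- l) b) \<in> A \<and> J b = b \<and> f = s + a + b \<and> f' = s' + sc l a + sc (- l) b"
proof -
  obtain s s' a b where *: "(s, s') \<in> S" "(a, sc l a) \<in> A" "(b, sc (- l) b) \<in> A"
    "f = s + a + b" "f' = s' + sc l a + sc (- l) b"
    using von_Neumann_decomposition[OF l S_eq_adj S_subset_A f(1)] by blast
  have "f = P s + P a + P b" "f' = P s' + sc l (P a) + sc (- l) (P b)"
    using P_eq[OF f(2)] P_eq[OF f(3)] *(4,5) by (metis P_add P_scale)+
  moreover have "(P a, sc l (P a)) \<in> A" "(P b, sc (- l) (P b)) \<in> A"
    using A_P[OF *(2)] A_P[OF *(3)] unfolding P_scale by blast+
  ultimately show ?thesis using S_P[OF *(1)] J_P by blast
qed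

lemma Tmax_plus_diff:
  "(x, w) \<in> Tmax_plus ip J T \<Longrightarrow> (y, z) \<in> Tmax_plus ip J T \<Longrightarrow> (x - y, w - z) \<in> Tmax_plus ip J T"
  by (auto simp: Tmax_plus_iff J_diff intro: adj_diff)

section \<open>The form isometry induced by T\<close>

context
  fixes k \<Gamma>0 \<Gamma>1
  assumes bt: "boundary_triple sc ip (Tmax_plus ip J T) k \<Gamma>0 \<Gamma>1"
begin

lemma bt_Cvec: "f \<in> Domain (Tmax_plus ip J T) \<Longrightarrow> \<Gamma>0 f \<in> Cvec k \<and> \<Gamma>1 f \<in> Cvec k"
  and bt_add: "f \<in> Domain (Tmax_plus ip J T) \<Longrightarrow> g \<in> Domain (Tmax_plus ip J T)
    \<Longrightarrow> \<Gamma>0 (f + g) = (\<lambda>j. \<Gamma>0 f j + \<Gamma>0 g j) \<and> \<Gamma>1 (f + g) = (\<lambda>j. \<Gamma>1 f j + \<Gamma>1 g j)"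
  and bt_scale: "f \<in> Domain (Tmax_plus ip J T)
    \<Longrightarrow> \<Gamma>0 (sc c f) = (\<lambda>j. c * \<Gamma>0 f j) \<and> \<Gamma>1 (sc c f) = (\<lambda>j. c * \<Gamma>1 f j)"
  and bt_Green: "(f, f') \<in> Tmax_plus ip J T \<Longrightarrow> (g, g') \<in> Tmax_plus ip J T
    \<Longrightarrow> ip f' g - ip f g' = cip k (\<Gamma>1 f) (\<Gamma>0 g) - cip k (\<Gamma>0 f) (\<Gamma>1 g)"
  and bt_surj: "a \<in> Cvec k \<Longrightarrow> b \<in> Cvec k \<Longrightarrow> \<exists>f\<in>Domain (Tmax_plus ip J T). \<Gamma>0 f = a \<and> \<Gamma>1 f = b"
  using bt unfolding boundary_triple_def by meson+

text \<open>If the boundary values vanish, Green's identity puts \<open>u\<close> into the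
  annihilator treated by \<open>T_plusI\<close>. Conversely, a pair in \<open>S\<close> is
  annihilated by all of \<open>Tmax_plus\<close>, and surjectivity supplies a \<open>y\<close> with
  boundary values \<open>(\<Gamma>1 u, 0)\<close> or \<open>(0, \<Gamma>0 u)\<close>, which turns
  the identity into the vanishing of a norm.\<close>

lemma bt_kernel:
  assumes u: "(u, u') \<in> Tmax_plus ip J T"
  shows "\<Gamma>0 u = (\<lambda>j. 0) \<and> \<Gamma>1 u = (\<lambda>j. 0) \<longleftrightarrow> (u, u') \<in> T"
proof
  assume 0: "\<Gamma>0 u = (\<lambda>j. 0) \<and> \<Gamma>1 u = (\<lambda>j. 0)"
  show "(u, u') \<in> T"
  proof (rule T_plusI)
    fix x w assume "(x, w) \<in> T"
    then have "(P x, P w) \<in> Tmax_plus ip J T"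
      using T_subset_A A_P by (auto simp: Tmax_plus_iff J_P)
    from bt_Green[OF this u] show "ip (P w) u = ip (P x) u'" by (simp add: 0)
  qed (use u in \<open>auto simp: Tmax_plus_iff\<close>)
next
  assume "(u, u') \<in> T"
  moreover have "J u = u" using u by (simp add: Tmax_plus_iff)
  ultimately have uS: "(u, u') \<in> S" by (rule T_plus)
  have eq: "cip k (\<Gamma>1 u) (\<Gamma>0 y) = cip k (\<Gamma>0 u) (\<Gamma>1 y)" if "y \<in> Domain (Tmax_plus ip J T)" for y
  proof -
    obtain z where z: "(y, z) \<in> Tmax_plus ip J T"
      using \<open>y \<in> Domain (Tmax_plus ip J T)\<close> by blast
    then have "ip u' y = ip u z" using uS by (auto simp: Tmax_plus_iff adj_iff)
    with bt_Green[OF u z] show ?thesis by simp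
  qed
  have C: "\<Gamma>0 u \<in> Cvec k" "\<Gamma>1 u \<in> Cvec k" "(\<lambda>j. 0) \<in> Cvec k"
    using bt_Cvec u by (auto simp: Cvec_def)
  obtain y where "y \<in> Domain (Tmax_plus ip J T)" "\<Gamma>0 y = \<Gamma>1 u" "\<Gamma>1 y = (\<lambda>j. 0)"
    using bt_surj[OF C(2,3)] by blast
  with eq[of y] C(2) have "\<Gamma>1 u = (\<lambda>j. 0)" by (auto intro: cip_self_eq_0)
  moreover obtain y where "y \<in> Domain (Tmax_plus ip J T)" "\<Gamma>1 y = \<Gamma>0 u" "\<Gamma>0 y = (\<lambda>j. 0)"
    using bt_surj[OF C(3,1)] by blast
  with eq[of y] C(1) have "\<Gamma>0 u = (\<lambda>j. 0)" by (auto intro: cip_self_eq_0)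
  ultimately show "\<Gamma>0 u = (\<lambda>j. 0) \<and> \<Gamma>1 u = (\<lambda>j. 0)" by simp
qed

lemma bt_eq_iff:
  assumes x: "(x, w) \<in> Tmax_plus ip J T" and y: "(y, z) \<in> Tmax_plus ip J T"
  shows "\<Gamma>0 x = \<Gamma>0 y \<and> \<Gamma>1 x = \<Gamma>1 y \<longleftrightarrow> (x - y, w - z) \<in> T"
proof -
  have d: "(x - y, w - z) \<in> Tmax_plus ip J T" by (rule Tmax_plus_diff[OF x y])
  have "\<Gamma>0 x = (\<lambda>j. \<Gamma>0 (x - y) j + \<Gamma>0 y j)" "\<Gamma>1 x = (\<lambda>j. \<Gamma>1 (x - y) j + \<Gamma>1 y j)"
    using bt_add[of "x - y" y] d y by auto
  then have "\<Gamma>0 x = \<Gamma>0 y \<and> \<Gamma>1 x = \<Gamma>1 y \<longleftrightarrow> \<Gamma>0 (x - y) = (\<lambda>j. 0) \<and> \<Gamma>1 (x - y) = (\<lambda>j. 0)"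
    by (simp add: fun_eq_iff)
  also have "\<dots> \<longleftrightarrow> (x - y, w - z) \<in> T" by (rule bt_kernel[OF d])
  finally show ?thesis .
qed

end

text \<open>Finite deficiency indices replace a proof that the projected graph of \<open>T\<close>
  is closed: modulo \<open>S\<close> only its finite-dimensional intersection with the defect pairs
  matters, and onto that a projection exists.\<close>

lemma T_plus_surj:
  assumes np: "has_dim sc {a. (a, sc \<i> a) \<in> A} m" and nm: "has_dim sc {a. (a, sc (- \<i>) a) \<in> A} n"
    and g: "(g, g') \<in> A" "J g = g" "J g' = g'"
  shows "\<exists>h h'. (h, h') \<in> T \<and> P h = g \<and> P h' = g'"
proof -
  let ?sc = "\<lambda>c v. (sc c (fst v), sc c (snd v))"
  interpret prod: hilbert ?sc "\<lambda>u v. ip (fst u) (fst v) + ip (snd u) (snd v)"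
    by (rule hilbert.intro) (rule hilbert_space_prod)
  obtain B where B: "finite B" "span B = {a. (a, sc \<i> a) \<in> A}" using np by (auto simp: has_dim_def)
  obtain C where C: "finite C" "span C = {a. (a, sc (- \<i>) a) \<in> A}" using nm by (auto simp: has_dim_def)
  \<comment> \<open>Annihilation by the boundary form is graph orthogonality after the rotation
    \<open>(q, q') \<mapsto> (q', - q)\<close>, which maps \<open>M\<close> to itself. Hence the component of a vector of \<open>M\<close>
    orthogonal to \<open>L \<inter> M\<close> rotates into \<open>S \<inter> M = 0\<close>.\<close>
  define L where "L = {(P x, P w) | x w. (x, w) \<in> T}"
  define M where "M = {(a + b, sc \<i> a + sc (- \<i>) b) | a b. (a, sc \<i> a) \<in> A \<and> (b, sc (- \<i>) b) \<in> A}"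
  define D where "D = (\<lambda>b. (b, sc \<i> b)) ` B \<union> (\<lambda>b. (b, sc (- \<i>) b)) ` C"
  have graph: "prod.span ((\<lambda>b. (b, sc l b)) ` E) = (\<lambda>b. (b, sc l b)) ` span E" for l E
  proof -
    interpret lin: Vector_Spaces.linear sc ?sc "\<lambda>b. (b, sc l b)"
      by unfold_locales (auto simp: scale_right_distrib mult.commute)
    show ?thesis by (rule lin.span_image)
  qed
  have "M \<subseteq> prod.span D"
  proof
    fix v assume "v \<in> M"
    then obtain a b where *: "a \<in> span B" "b \<in> span C" "v = (a + b, sc \<i> a + sc (- \<i>) b)"
      unfolding M_def B C by blast
    then have "v = (a, sc \<i> a) + (b, sc (- \<i>) b)" by simp
    then show "v \<in> prod.span D" unfolding D_def prod.span_Un graph using * by blast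
  qed
  have M_subspace: "prod.subspace M"
  proof (rule prod.subspaceI)
    show "0 \<in> M" unfolding M_def using adj_zero by (auto simp: zero_prod_def intro!: exI[of _ 0])
  next
    fix u v assume "u \<in> M" "v \<in> M"
    then obtain a b a' b' where *: "(a, sc \<i> a) \<in> A" "(b, sc (- \<i>) b) \<in> A" "(a', sc \<i> a') \<in> A"
      "(b', sc (- \<i>) b') \<in> A" "u = (a + b, sc \<i> a + sc (- \<i>) b)" "v = (a' + b', sc \<i> a' + sc (- \<i>) b')"
      unfolding M_def by auto
    have "u + v = ((a + a') + (b + b'), sc \<i> (a + a') + sc (- \<i>) (b + b'))"
      using * by (simp add: scale_right_distrib)
    moreover have "(a + a', sc \<i> (a + a')) \<in> A" "(b + b', sc (- \<i>) (b + b')) \<in> A"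
      using adj_add[OF *(1) *(3)] adj_add[OF *(2) *(4)] by (simp_all only: scale_right_distrib)
    ultimately show "u + v \<in> M" unfolding M_def by blast
  next
    fix c u assume "u \<in> M"
    then obtain a b where *: "(a, sc \<i> a) \<in> A" "(b, sc (- \<i>) b) \<in> A"
      "u = (a + b, sc \<i> a + sc (- \<i>) b)" unfolding M_def by auto
    have "?sc c u = (sc c a + sc c b, sc \<i> (sc c a) + sc (- \<i>) (sc c b))"
      using * by (simp add: scale_right_distrib scale_right_diff_distrib mult.commute)
    moreover have "(sc c a, sc \<i> (sc c a)) \<in> A" "(sc c b, sc (- \<i>) (sc c b)) \<in> A"
      using adj_scale[OF *(1), of c] adj_scale[OF *(2), of c] by (simp_all add: mult.commute)
    ultimately show "?sc c u \<in> M" unfolding M_def by blast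
  qed
  have "0 = (P 0, P 0)" by (simp add: zero_prod_def)
  then have L_zero: "0 \<in> L" unfolding L_def using T_zero by blast
  have L_add: "u + v \<in> L" if uv: "u \<in> L" "v \<in> L" for u v
  proof -
    obtain x w y z where "u = (P x, P w)" "v = (P y, P z)" "(x, w) \<in> T" "(y, z) \<in> T"
      using uv unfolding L_def by auto
    then have "u + v = (P (x + y), P (w + z))" "(x + y, w + z) \<in> T" by (auto simp: P_add T_add)
    then show ?thesis unfolding L_def by blast
  qed
  have L_scale: "?sc c u \<in> L" if u: "u \<in> L" for c u
  proof -
    obtain x w where "u = (P x, P w)" "(x, w) \<in> T" using u unfolding L_def by auto
    then have "?sc c u = (P (sc c x), P (sc c w))" "(sc c x, sc c w) \<in> T" by (auto simp: P_scale T_scale)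
    then show ?thesis unfolding L_def by blast
  qed
  have L_diff: "u - v \<in> L" if "u \<in> L" "v \<in> L" for u v
    using L_add[OF that(1) L_scale[OF that(2), of "-1"]] by (simp flip: uminus_prod_def)
  have L_subspace: "prod.subspace L"
    by (rule prod.subspaceI) (use L_zero L_add L_scale in auto)
  have S_L: "(s, s') \<in> L" if s: "(s, s') \<in> S" "J s = s" for s s'
  proof -
    have "(s, s') \<in> T" using s S_subset_T by auto
    moreover have "P s = s" "P s' = s'" using s(2) T_plus(1)[OF \<open>(s, s') \<in> T\<close>] by (auto simp: P_eq)
    ultimately show ?thesis unfolding L_def by (metis (mono_tags, lifting) mem_Collect_eq)
  qed
  have M_A: "v \<in> A" if v: "v \<in> M" for v
    using v unfolding M_def by (auto intro!: adj_add simp del: scale_minus_left)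
  have S_M: "ip s x + ip s' w = 0" if s: "(s, s') \<in> S" and v: "(x, w) \<in> M" for s s' x w
  proof -
    obtain a b where *: "(a, sc \<i> a) \<in> A" "(b, sc (- \<i>) b) \<in> A"
      "x = a + b" "w = sc \<i> a + sc (- \<i>) b" using v unfolding M_def by auto
    have "ip s a + ip s' (sc \<i> a) = 0" "ip s b + ip s' (sc (- \<i>) b) = 0"
      using defect_orthogonal[OF _ s *(1)] defect_orthogonal[OF _ s *(2)] by simp_all
    then show ?thesis
      unfolding *(3,4) ip_add_right by (metis (no_types, lifting) add.commute add.left_commute add_0)
  qed
  have split: "\<exists>s s' v. (s, s') \<in> S \<and> J s = s \<and> v \<in> M \<and> (f, f') = (s, s') + v"
    if f: "(f, f') \<in> A" "J f = f" "J f' = f'" for f f'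
  proof -
    obtain s s' a b where *: "(s, s') \<in> S" "J s = s" "(a, sc \<i> a) \<in> A" "(b, sc (- \<i>) b) \<in> A"
      "f = s + a + b" "f' = s' + sc \<i> a + sc (- \<i>) b"
      using von_Neumann_plus[OF _ f, of \<i>] by auto
    have "(a + b, sc \<i> a + sc (- \<i>) b) \<in> M" unfolding M_def using * by blast
    moreover have "(f, f') = (s, s') + (a + b, sc \<i> a + sc (- \<i>) b)"
      using * by (simp add: add.assoc)
    ultimately show ?thesis using * by blast
  qed
  obtain s s' v where v: "(s, s') \<in> S" "J s = s" "v \<in> M" "(g, g') = (s, s') + v"
    using split[OF g] by blast
  have "finite D" unfolding D_def using B C by simp
  moreover have "L \<inter> M \<subseteq> prod.span D" using \<open>M \<subseteq> prod.span D\<close> by blast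
  moreover have "prod.subspace (L \<inter> M)" using L_subspace M_subspace by (rule prod.subspace_inter)
  ultimately obtain p where p: "p \<in> L \<inter> M"
    "\<And>w. w \<in> L \<inter> M \<Longrightarrow> ip (fst (v - p)) (fst w) + ip (snd (v - p)) (snd w) = 0"
    using prod.projection_finite_dim_subspace[of D "L \<inter> M" v] by blast
  obtain q q' where q: "v - p = (q, q')" by (cases "v - p")
  have qM: "(q, q') \<in> M" using prod.subspace_diff[OF M_subspace] v(3) p(1) q by (metis IntD2)
  have Js': "J s' = s'" using T_plus(1) v(1,2) S_subset_T by blast
  have Jv: "J (fst v) = fst v" "J (snd v) = snd v"
  proof -
    have "fst v = g - s" "snd v = g' - s'" using v(4) by (cases v, simp)+
    then show "J (fst v) = fst v" "J (snd v) = snd v" using g v(2) Js' by (auto simp: J_diff)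
  qed
  have Jp: "J (fst p) = fst p" "J (snd p) = snd p" using p(1) unfolding L_def by (auto simp: J_P)
  have Jq: "J q = q" "J q' = q'"
  proof -
    have "q = fst v - fst p" "q' = snd v - snd p" using q by (metis fst_conv fst_diff, metis snd_conv snd_diff)
    then show "J q = q" "J q' = q'" using Jv Jp by (auto simp: J_diff)
  qed
  \<comment> \<open>Subtracting the \<open>S\<close>-part \<open>(t, t')\<close> from
    \<open>(P x, P w)\<close> leaves a vector of \<open>L \<inter> M\<close>, to which the residual
    is orthogonal by choice of \<open>p\<close>; the \<open>S\<close>-part is orthogonal to all of
    \<open>M\<close>.\<close>
  have orth: "ip (P x) q + ip (P w) q' = 0" if xw: "(x, w) \<in> T" for x w
  proof -
    have "(P x, P w) \<in> A" using xw T_subset_A A_P by blast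
    then obtain t t' u where t: "(t, t') \<in> S" "J t = t" "u \<in> M" "(P x, P w) = (t, t') + u"
      using split J_P by blast
    have "u = (P x, P w) - (t, t')" using t(4) by simp
    moreover have "(P x, P w) \<in> L" unfolding L_def using xw by blast
    ultimately have "u \<in> L" using L_diff S_L t(1,2) by blast
    then have "ip q (fst u) + ip q' (snd u) = 0" using p(2)[of u] t(3) q by auto
    then have "ip (fst u) q + ip (snd u) q' = 0"
      by (metis complex_cnj_add complex_cnj_zero ip_cnj)
    moreover have "ip t q + ip t' q' = 0" using S_M t(1) qM by blast
    moreover have "P x = t + fst u" "P w = t' + snd u" using t(4) by (cases u, simp)+
    ultimately show ?thesis by (simp add: ip_add_left algebra_simps)
  qed
  have "(q', - q) \<in> T"
  proof (rule T_plusI)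
    fix x w assume "(x, w) \<in> T"
    from orth[OF this] show "ip (P w) q' = ip (P x) (- q)"
      by (simp add: ip_minus_right eq_neg_iff_add_eq_0 add.commute)
  qed (auto simp: Jq J_minus)
  then have "(q', - q) \<in> S" using T_plus(2) Jq by blast
  moreover have "(q', - q) \<in> M"
  proof -
    obtain a b where *: "(a, sc \<i> a) \<in> A" "(b, sc (- \<i>) b) \<in> A"
      "q = a + b" "q' = sc \<i> a + sc (- \<i>) b" using qM unfolding M_def by auto
    \<comment> \<open>The rotated pair is generated by the defect vectors \<open>sc \<i> a\<close>
      and \<open>sc (- \<i>) b\<close>.\<close>
    have "- q = sc \<i> (sc \<i> a) + sc (- \<i>) (sc (- \<i>) b)" using *(3) by (simp add: scale_minus_left[of 1, simplified])
    moreover have "(sc \<i> a, sc \<i> (sc \<i> a)) \<in> A" "(sc (- \<i>) b, sc (- \<i>) (sc (- \<i>) b)) \<in> A"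
      using adj_scale[OF *(1), of \<i>] adj_scale[OF *(2), of "- \<i>"] by simp_all
    ultimately show ?thesis unfolding M_def *(4) by blast
  qed
  ultimately have "ip q' q' + ip (- q) (- q) = 0" by (rule S_M)
  then have "q = 0" "q' = 0" by (auto simp: ip_sum_eq_0_iff)
  then have "v = p" using q by (simp add: zero_prod_def[symmetric])
  then have "(g, g') \<in> L" using v(4) L_add[OF S_L[OF v(1,2)]] p(1) by auto
  then show ?thesis unfolding L_def by auto
qed

text \<open>An inertia argument: divided by 2\<i>, the boundary form is positive on the defect
  vectors for \<i> and negative on those for its negative, so an isometry modulo \<open>S\<close>
  cannot carry a nonzero vector of one kind into the other.\<close>

lemma defect_plus_le_minus:
  assumes np: "has_dim sc {a. (a, sc \<i> a) \<in> A} m" and nm: "has_dim sc {a. (a, sc (- \<i>) a) \<in> A} n"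
    and l: "l * l = - 1" and k: "has_dim sc {a. (a, sc l a) \<in> A \<and> J a = a} k"
    and k': "has_dim sc {a. (a, sc l a) \<in> A \<and> J a = - a} k'"
  shows "k \<le> k'"
proof -
  interpret neg: J_self_adjoint_operator sc ip "\<lambda>x. - J x" T by (rule neg)
  \<comment> \<open>\<open>R f a\<close>: the bijection induced by \<open>T\<close> maps the class of \<open>f\<close> to that of \<open>a + b\<close>, with \<open>b\<close> in the
    opposite defect space. If \<open>a = 0\<close>, the forms have opposite signs at \<open>f\<close> and \<open>b\<close>, so \<open>f = 0\<close>.\<close>
  define R where "R f a \<longleftrightarrow> (\<exists>h h' s s' b. (h, h') \<in> T \<and> P h = f \<and> P h' = sc l f \<and> (s, s') \<in> S
    \<and> (b, sc (- l) b) \<in> A \<and> Q h = s + a + b \<and> Q h' = s' + sc l a + sc (- l) b)" for f a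
  have RI: "R f a" if "(h, h') \<in> T" "P h = f" "P h' = sc l f" "(s, s') \<in> S"
    "(b, sc (- l) b) \<in> A" "Q h = s + a + b" "Q h' = s' + sc l a + sc (- l) b" for f a h h' s s' b
    unfolding R_def using that by blast
  \<comment> \<open>Unexpanded, \<open>sc (- l) b\<close> keeps its shape as the image of
    \<open>b\<close> in the opposite defect space.\<close>
  note [simp del] = scale_minus_left
  show ?thesis
  proof (rule has_dim_le_if_linear_relation[OF vector_space_axioms k k', of R])
    show "R (f + g) (a + c)" if fa: "R f a" and gc: "R g c" for f a g c
    proof -
      obtain h h' s s' b where 1: "(h, h') \<in> T" "P h = f" "P h' = sc l f" "(s, s') \<in> S"
        "(b, sc (- l) b) \<in> A" "Q h = s + a + b" "Q h' = s' + sc l a + sc (- l) b"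
        using fa unfolding R_def by blast
      obtain j j' t t' d where 2: "(j, j') \<in> T" "P j = g" "P j' = sc l g" "(t, t') \<in> S"
        "(d, sc (- l) d) \<in> A" "Q j = t + c + d" "Q j' = t' + sc l c + sc (- l) d"
        using gc unfolding R_def by blast
      show ?thesis
      proof (rule RI[of "h + j" "h' + j'" _ "s + t" "s' + t'" "b + d"])
        show "(s + t, s' + t') \<in> S" using 1(4) 2(4) by (simp add: S_iff T_add J_add)
        show "(b + d, sc (- l) (b + d)) \<in> A"
          using adj_add[OF 1(5) 2(5)] by (simp add: scale_right_distrib)
      qed (use 1 2 in \<open>simp_all add: T_add P_add neg.P_add scale_right_distrib algebra_simps\<close>)
    qed
    show "R (sc e f) (sc e a)" if fa: "R f a" for e f a
    proof -
      obtain h h' s s' b where 1: "(h, h') \<in> T" "P h = f" "P h' = sc l f" "(s, s') \<in> S"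
        "(b, sc (- l) b) \<in> A" "Q h = s + a + b" "Q h' = s' + sc l a + sc (- l) b"
        using fa unfolding R_def by blast
      show ?thesis
      proof (rule RI[of "sc e h" "sc e h'" _ "sc e s" "sc e s'" "sc e b"])
        show "(sc e s, sc e s') \<in> S" using 1(4) by (simp add: S_iff T_scale J_scale)
        show "(sc e b, sc (- l) (sc e b)) \<in> A"
          using adj_scale[OF 1(5), of e] by (simp add: mult.commute)
      qed (use 1 in \<open>simp_all add: T_scale P_scale neg.P_scale scale_right_distrib mult.commute\<close>)
    qed
    show "\<exists>a\<in>{a. (a, sc l a) \<in> A \<and> J a = - a}. R f a" if f: "f \<in> {a. (a, sc l a) \<in> A \<and> J a = a}" for f
    proof -
      have "(f, sc l f) \<in> A" "J f = f" "J (sc l f) = sc l f" using f by (auto simp: J_scale)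
      from T_plus_surj[OF np nm this]
      obtain h h' where h: "(h, h') \<in> T" "P h = f" "P h' = sc l f" by blast
      then have "(Q h, Q h') \<in> A" using T_subset_A neg.A_P by blast
      from neg.von_Neumann_plus[OF l this neg.J_P neg.J_P]
      obtain s s' a b where "(s, s') \<in> S" "(a, sc l a) \<in> A" "- J a = a" "(b, sc (- l) b) \<in> A"
        "Q h = s + a + b" "Q h' = s' + sc l a + sc (- l) b" by blast
      then show ?thesis using RI[OF h] by (intro bexI[of _ a]) (auto simp: J_eq_minus_iff)
    qed
    show "f = 0" if "f \<in> {a. (a, sc l a) \<in> A \<and> J a = a}" and R0: "R f 0" for f
    proof -
      obtain h h' s s' b where h: "(h, h') \<in> T" "P h = f" "P h' = sc l f" "(s, s') \<in> S"
        "(b, sc (- l) b) \<in> A" "Q h = s + 0 + b" "Q h' = s' + sc l 0 + sc (- l) b"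
        using R0 unfolding R_def by blast
      have l0: "l \<noteq> 0" using l by auto
      have sb: "ip s' b = ip s (sc (- l) b)" using h(4,5) by (auto simp: adj_iff)
      then have bs: "ip b s' = ip (sc (- l) b) s" by (metis ip_cnj)
      have ss: "ip s' s = ip s s'" using h(4) S_subset_A by (auto simp: adj_iff)
      \<comment> \<open>The \<open>S\<close>-part \<open>(s, s')\<close> drops out of the form on
        the minus side, which leaves opposite multiples of \<open>ip f f\<close> and
        \<open>ip b b\<close>.\<close>
      have "ip (sc l f) f - ip f (sc l f) = ip (Q h') (Q h) - ip (Q h) (Q h')"
        using T_form[OF h(1) h(1)] h(2,3) by simp
      also have "\<dots> = ip (sc (- l) b) b - ip b (sc (- l) b)"
        using sb bs ss by (simp add: h(6,7) ip_add_left ip_add_right)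
      finally have "l * ip f f = - (l * ip b b)"
        using cnj_square_minus_one[OF l] by (simp add: ip_scale_left ip_scale_right algebra_simps)
      then have "l * (ip f f + ip b b) = 0" by (simp add: distrib_left)
      then show ?thesis using l0 by (simp add: ip_sum_eq_0_iff)
    qed
  qed
qed

text \<open>\<open>P\<close> and \<open>Q\<close> split each defect space into its parts in the two
  eigenspaces of \<open>J\<close>. The preceding inequality, applied to \<open>J\<close> and to
  \<open>- J\<close>, makes the two dimensions equal.\<close>

lemma defect_halves:
  assumes np: "has_dim sc {a. (a, sc \<i> a) \<in> A} m" and nm: "has_dim sc {a. (a, sc (- \<i>) a) \<in> A} n"
    and l: "l * l = - 1" and N: "has_dim sc {a. (a, sc l a) \<in> A} k"
  shows "even k \<and> has_dim sc {a. (a, sc l a) \<in> A \<and> J a = a} (k div 2)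
    \<and> has_dim sc {a. (a, sc l a) \<in> A \<and> J a = - a} (k div 2)"
proof -
  interpret neg: J_self_adjoint_operator sc ip "\<lambda>x. - J x" T by (rule neg)
  let ?V = "{a. (a, sc l a) \<in> A \<and> J a = a}" and ?W = "{a. (a, sc l a) \<in> A \<and> J a = - a}"
  have "subspace ?V" "subspace ?W"
    using adj_add[of _ "sc l _" S _ "sc l _"] adj_scale[of _ "sc l _" S] adj_zero[of S]
    by (auto simp: subspace_def J_add J_scale scale_right_distrib mult.commute)
  then obtain i j where V: "has_dim sc ?V i" and W: "has_dim sc ?W j"
    using has_dim_subspace_exists[OF vector_space_axioms N, of ?V]
      has_dim_subspace_exists[OF vector_space_axioms N, of ?W] by auto
  have "i \<le> j" by (rule defect_plus_le_minus[OF np nm l V W])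
  moreover have "j \<le> i"
    by (rule neg.defect_plus_le_minus[OF np nm l]) (use V W in \<open>simp_all add: J_eq_minus_iff\<close>)
  ultimately have "i = j" by simp
  have "v = 0" if "J v = v" "J v = - v" for v
  proof -
    have "v = sc (1/2) (v + v)" by (simp add: half_double)
    also have "v + v = v + - v" using that by simp
    finally show ?thesis by simp
  qed
  then have "?V \<inter> ?W \<subseteq> {0}" by blast
  moreover have "{x + y | x y. x \<in> ?V \<and> y \<in> ?W} = {a. (a, sc l a) \<in> A}"
  proof (intro set_eqI iffI)
    fix a assume "a \<in> {x + y | x y. x \<in> ?V \<and> y \<in> ?W}"
    then show "a \<in> {a. (a, sc l a) \<in> A}" by (auto simp: scale_right_distrib intro: adj_add)
  next
    fix a assume a: "a \<in> {a. (a, sc l a) \<in> A}"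
    then have "(P a, sc l (P a)) \<in> A" "(Q a, sc l (Q a)) \<in> A"
      using A_P[of a "sc l a"] neg.A_P[of a "sc l a"] by (auto simp: P_scale neg.P_scale)
    moreover have "J (Q a) = - Q a" using neg.J_P J_eq_minus_iff by blast
    ultimately show "a \<in> {x + y | x y. x \<in> ?V \<and> y \<in> ?W}"
      using J_P[of a] P_Q[of a] by (intro CollectI exI[of _ "P a"] exI[of _ "Q a"]) auto
  qed
  ultimately have "k = i + j"
    using has_dim_direct_sum[OF vector_space_axioms V W] N by simp
  then show ?thesis using V W \<open>i = j\<close> by simp
qed

text \<open>The new boundary values at \<open>Q h\<close> are the old ones at \<open>P h\<close>,
  for \<open>h\<close> in the domain of \<open>T\<close>. \<open>T_plus_surj\<close> for
  \<open>- J\<close> makes them defined everywhere and for \<open>J\<close> makes them surjective;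
  \<open>T_form\<close> carries over Green's identity.\<close>

lemma boundary_triple_minus_exists:
  assumes np: "has_dim sc {a. (a, sc \<i> a) \<in> A} m" and nm: "has_dim sc {a. (a, sc (- \<i>) a) \<in> A} n"
    and bt: "boundary_triple sc ip (Tmax_plus ip J T) k \<Gamma>0 \<Gamma>1"
  shows "\<exists>\<Delta>0 \<Delta>1. boundary_triple sc ip (Tmax_plus ip (\<lambda>x. - J x) T) k \<Delta>0 \<Delta>1
    \<and> Domain T = {h. P h \<in> Domain (Tmax_plus ip J T) \<and> Q h \<in> Domain (Tmax_plus ip (\<lambda>x. - J x) T)
        \<and> \<Gamma>0 (P h) = \<Delta>0 (Q h) \<and> \<Gamma>1 (P h) = \<Delta>1 (Q h)}"
proof -
  interpret neg: J_self_adjoint_operator sc ip "\<lambda>x. - J x" T by (rule neg)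
  let ?Ap = "Tmax_plus ip J T" and ?Am = "Tmax_plus ip (\<lambda>x. - J x) T"
  \<comment> \<open>\<open>H\<close> picks an arbitrary lift and need not be linear;
    \<open>eq_if_Q\<close> shows that the boundary values do not depend on the choice.\<close>
  define H where "H g = (SOME h. h \<in> Domain T \<and> Q h = g)" for g
  define \<Delta>0 \<Delta>1 where "\<Delta>0 g = \<Gamma>0 (P (H g))" and "\<Delta>1 g = \<Gamma>1 (P (H g))" for g
  have PQ: "(P h, P h') \<in> ?Ap" "(Q h, Q h') \<in> ?Am" if "(h, h') \<in> T" for h h'
  proof -
    have "(h, h') \<in> A" using that T_subset_A by blast
    then show "(P h, P h') \<in> ?Ap" "(Q h, Q h') \<in> ?Am"
      using A_P neg.A_P J_P neg.J_P by (auto simp: Tmax_plus_iff neg.Tmax_plus_iff)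
  qed
  have eq_if_Q: "\<Gamma>0 (P h) = \<Gamma>0 (P j) \<and> \<Gamma>1 (P h) = \<Gamma>1 (P j)"
    if h: "(h, h') \<in> T" and j: "(j, j') \<in> T" and Q: "Q h = Q j" for h h' j j'
  proof -
    \<comment> \<open>Single-valuedness of \<open>A\<close> extends the agreement of the
      \<open>Q\<close>-components to the images, so the difference of the two pairs of
      \<open>T\<close> lies entirely on the plus side.\<close>
    have "Q h' = Q j'"
      using PQ(2)[OF h] PQ(2)[OF j] Q A_functional by (auto simp: neg.Tmax_plus_iff)
    moreover have "u - v = P u - P v" if "Q u = Q v" for u v
      using P_Q[of u] P_Q[of v] that by (metis add_diff_cancel_right)
    ultimately have "(P h - P j, P h' - P j') \<in> T"
      using T_diff[OF h j] Q by metis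
    then show ?thesis using bt_eq_iff[OF bt PQ(1)[OF h] PQ(1)[OF j]] by simp
  qed
  have \<Delta>: "\<Delta>0 (Q h) = \<Gamma>0 (P h)" "\<Delta>1 (Q h) = \<Gamma>1 (P h)" if h: "(h, h') \<in> T" for h h'
  proof -
    have "H (Q h) \<in> Domain T \<and> Q (H (Q h)) = Q h"
      unfolding H_def by (rule someI[of _ h]) (use h in auto)
    then obtain j where "(H (Q h), j) \<in> T" "Q (H (Q h)) = Q h" by blast
    from eq_if_Q[OF this(1) h this(2)]
    show "\<Delta>0 (Q h) = \<Gamma>0 (P h)" "\<Delta>1 (Q h) = \<Gamma>1 (P h)" by (simp_all add: \<Delta>0_def \<Delta>1_def)
  qed
  have lift: "\<exists>h h'. (h, h') \<in> T \<and> Q h = g \<and> Q h' = g'" if "(g, g') \<in> ?Am" for g g'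
    using that neg.T_plus_surj[OF np nm, of g g'] by (simp add: neg.Tmax_plus_iff)
  have "boundary_triple sc ip ?Am k \<Delta>0 \<Delta>1"
    unfolding boundary_triple_def
  proof (intro conjI ballI allI impI)
    fix f assume "f \<in> Domain ?Am"
    then obtain h h' where h: "(h, h') \<in> T" "Q h = f" using lift by blast
    then have PD: "P h \<in> Domain ?Ap" using PQ by blast
    show "\<Delta>0 f \<in> Cvec k" "\<Delta>1 f \<in> Cvec k"
      using \<Delta>[OF h(1)] h(2) bt_Cvec[OF bt PD] by simp_all
    fix c
    have "(sc c h, sc c h') \<in> T" using h(1) by (rule T_scale)
    from \<Delta>[OF this]
    show "\<Delta>0 (sc c f) = (\<lambda>j. c * \<Delta>0 f j)" "\<Delta>1 (sc c f) = (\<lambda>j. c * \<Delta>1 f j)"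
      using \<Delta>[OF h(1)] h(2) bt_scale[OF bt PD, of c] by (simp_all add: P_scale neg.P_scale)
  next
    fix f g assume "f \<in> Domain ?Am" "g \<in> Domain ?Am"
    then obtain h h' j j' where h: "(h, h') \<in> T" "Q h = f" and j: "(j, j') \<in> T" "Q j = g"
      using lift by (metis DomainE)
    then have PD: "P h \<in> Domain ?Ap" "P j \<in> Domain ?Ap" using PQ by blast+
    have "(h + j, h' + j') \<in> T" using h(1) j(1) by (rule T_add)
    from \<Delta>[OF this]
    show "\<Delta>0 (f + g) = (\<lambda>j. \<Delta>0 f j + \<Delta>0 g j)" "\<Delta>1 (f + g) = (\<lambda>j. \<Delta>1 f j + \<Delta>1 g j)"
      using \<Delta>[OF h(1)] \<Delta>[OF j(1)] h(2) j(2) bt_add[OF bt PD] by (simp_all add: P_add neg.P_add)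
  next
    fix f f' g g' assume "(f, f') \<in> ?Am" "(g, g') \<in> ?Am"
    then obtain h h' j j' where h: "(h, h') \<in> T" "Q h = f" "Q h' = f'"
      and j: "(j, j') \<in> T" "Q j = g" "Q j' = g'" using lift by metis
    show "ip f' g - ip f g' = cip k (\<Delta>1 f) (\<Delta>0 g) - cip k (\<Delta>0 f) (\<Delta>1 g)"
      using T_form[OF h(1) j(1)] bt_Green[OF bt PQ(1)[OF h(1)] PQ(1)[OF j(1)]]
        \<Delta>[OF h(1)] \<Delta>[OF j(1)] h(2,3) j(2,3) by simp
  next
    fix a b assume "a \<in> Cvec k" "b \<in> Cvec k"
    then obtain f f' where f: "(f, f') \<in> ?Ap" "\<Gamma>0 f = a" "\<Gamma>1 f = b"
      using bt_surj[OF bt] by blast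
    then obtain h h' where h: "(h, h') \<in> T" "P h = f"
      using T_plus_surj[OF np nm, of f f'] by (auto simp: Tmax_plus_iff)
    then show "\<exists>f\<in>Domain ?Am. \<Delta>0 f = a \<and> \<Delta>1 f = b"
      using \<Delta>[OF h(1)] f(2,3) PQ(2)[OF h(1)] by (intro bexI[of _ "Q h"]) auto
  qed
  moreover have "h \<in> Domain T" if Ph: "P h \<in> Domain ?Ap" and Qh: "Q h \<in> Domain ?Am"
    and eq: "\<Gamma>0 (P h) = \<Delta>0 (Q h)" "\<Gamma>1 (P h) = \<Delta>1 (Q h)" for h
  proof -
    obtain f' where f': "(P h, f') \<in> ?Ap" using Ph by blast
    \<comment> \<open>\<open>j\<close> is an element of the domain of \<open>T\<close> with the same
      \<open>Q\<close>-component as \<open>h\<close>. Equal boundary values put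
      \<open>P h - P j\<close> into that domain, and adding \<open>j\<close> recovers
      \<open>h\<close>.\<close>
    obtain j j' where j: "(j, j') \<in> T" "Q j = Q h" using lift Qh by blast
    have "(P h - P j, f' - P j') \<in> T"
      using bt_eq_iff[OF bt f' PQ(1)[OF j(1)]] eq \<Delta>[OF j(1)] j(2) by simp
    from T_add[OF this j(1)] have "P h - P j + j \<in> Domain T" by blast
    moreover have "P h - P j + j = h"
      using P_Q[of h] P_Q[of j] j(2) by (metis add_diff_cancel_left' add_diff_eq diff_add_cancel)
    ultimately show ?thesis by simp
  qed
  moreover have "P h \<in> Domain ?Ap \<and> Q h \<in> Domain ?Am \<and> \<Gamma>0 (P h) = \<Delta>0 (Q h) \<and> \<Gamma>1 (P h) = \<Delta>1 (Q h)"
    if "h \<in> Domain T" for h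
    using that PQ \<Delta> by (metis DomainE DomainI)
  ultimately show ?thesis by blast
qed

end

theorem theorem2p4:
  fixes sc :: "complex \<Rightarrow> 'a::ab_group_add \<Rightarrow> 'a"
    and ip :: "'a \<Rightarrow> 'a \<Rightarrow> complex"
    and J :: "'a \<Rightarrow> 'a"
    and T :: "('a \<times> 'a) set"
    and m :: nat
  assumes H: "hilbert_space sc ip"
    and J: "signature_op sc ip J"
    and T: "J_self_adjoint sc ip J T"
    and dense: "hdense ip (Domain (Tmin ip T))"
    and np: "def_index_plus_is sc ip UNIV (Tmin ip T) m"
    and nm: "def_index_minus_is sc ip UNIV (Tmin ip T) m"
  shows "even m \<and>
     def_index_plus_is sc ip (Hplus J) (Tmin_plus ip J T) (m div 2) \<and>
     def_index_minus_is sc ip (Hplus J) (Tmin_plus ip J T) (m div 2) \<and>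
     def_index_plus_is sc ip (Hminus J) (Tmin_minus ip J T) (m div 2) \<and>
     def_index_minus_is sc ip (Hminus J) (Tmin_minus ip J T) (m div 2) \<and>
     (\<forall>\<Gamma>0p \<Gamma>1p. boundary_triple sc ip (Tmax_plus ip J T) (m div 2) \<Gamma>0p \<Gamma>1p \<longrightarrow>
        (\<exists>\<Gamma>0m \<Gamma>1m. boundary_triple sc ip (Tmax_minus ip J T) (m div 2) \<Gamma>0m \<Gamma>1m \<and>
           Domain T = {h. orth_proj ip (Hplus J) h \<in> Domain (Tmax_plus ip J T) \<and>
                          orth_proj ip (Hminus J) h \<in> Domain (Tmax_minus ip J T) \<and>
                          \<Gamma>0p (orth_proj ip (Hplus J) h) = \<Gamma>0m (orth_proj ip (Hminus J) h) \<and>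
                          \<Gamma>1p (orth_proj ip (Hplus J) h) = \<Gamma>1m (orth_proj ip (Hminus J) h)}))"
proof -
  interpret J_self_adjoint_operator sc ip J T
    by unfold_locales (rule H J T dense)+
  interpret neg: J_self_adjoint_operator sc ip "\<lambda>x. - J x" T by (rule neg)
  have Np: "has_dim sc {a. (a, sc \<i> a) \<in> A} m" and Nm: "has_dim sc {a. (a, sc (- \<i>) a) \<in> A} m"
    using np nm by (simp_all only: def_index_plus_is_def def_index_minus_is_def defect_space_def)
  \<comment> \<open>The minus-side objects are the plus-side objects of \<open>- J\<close>, so the
    interpretation \<open>neg\<close> covers them.\<close>
  have minus: "Hminus J = Hplus (\<lambda>x. - J x)" "Tmin_minus ip J T = Tmin_plus ip (\<lambda>x. - J x) T"
    "Tmax_minus ip J T = Tmax_plus ip (\<lambda>x. - J x) T"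
  proof -
    show *: "Hminus J = Hplus (\<lambda>x. - J x)" by (auto simp: Hminus_def Hplus_def J_eq_minus_iff)
    then show "Tmin_minus ip J T = Tmin_plus ip (\<lambda>x. - J x) T"
      by (simp add: Tmin_minus_def Tmin_plus_def)
    with * show "Tmax_minus ip J T = Tmax_plus ip (\<lambda>x. - J x) T"
      by (simp add: Tmax_minus_def Tmax_plus_def)
  qed
  have halves: "even m" "has_dim sc {a. (a, sc \<i> a) \<in> A \<and> J a = a} (m div 2)"
    "has_dim sc {a. (a, sc \<i> a) \<in> A \<and> - J a = a} (m div 2)"
    "has_dim sc {a. (a, sc (- \<i>) a) \<in> A \<and> J a = a} (m div 2)"
    "has_dim sc {a. (a, sc (- \<i>) a) \<in> A \<and> - J a = a} (m div 2)"
    using defect_halves[OF Np Nm _ Np] defect_halves[OF Np Nm _ Nm]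
    unfolding J_eq_minus_iff by simp_all
  show ?thesis
    unfolding minus orth_proj_Hplus neg.orth_proj_Hplus def_index_plus_is_def def_index_minus_is_def
      defect_space_plus neg.defect_space_plus
    using halves boundary_triple_minus_exists[OF Np Nm] by blast
qed

end
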